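(* Let $M$ be a smooth manifold (Hausdorff, second-countable, finite dimensional and without boundary), regarded as a diffeological space with its standard diffeology. Then the free diffeological vector space $F(M)$ generated by $M$ is projective.
   Context: A diffeological space is a set $X$ together with a specified set of functions $U\to X$ (called plots), for every open set $U\subseteq\mathbb{R}^n$ and every $n\in\mathbb{N}=\{0,1,2,\dots\}$, such that: (1) every constant map $U\to X$ is a plot; (2) if $U\to X$ is a plot and $V\to U$ is a smooth map between open subsets of Euclidean spaces, then $V\to U\to X$ is a plot; (3) if $U=\bigcup_i U_i$ is an open cover and $U\to X$ is a map whose restrictions to all $U_i$ are plots, then $U\to X$ is a plot. A map between diffeological spaces is smooth if composing with it sends plots to plots. The standard diffeology on a smooth manifold $M$ has as plots all usual smooth maps $U\to M$. Products carry the product diffeology (a map into a product is a plot iff all its components are plots). A diffeological vector space is a real vector space $V$ with a diffeology such that addition $V\times V\to V$ and scalar multiplication $\mathbb{R}\times V\to V$ are smooth. For a diffeological space $X$, the free diffeological vector space $F(X)$ generated by $X$ is the free real vector space on the underlying set of $X$ (basis elements written $[x]$), with the diffeology generated by all maps $\mathbb{R}\times U_1\times\cdots\times\mathbb{R}\times U_n\to F(X)$, $(r_1,u_1,\dots,r_n,u_n)\mapsto r_1[p_1(u_1)]+\cdots+r_n[p_n(u_n)]$, for all $n\ge 1$ and all plots $p_i:U_i\to X$; it is the smallest diffeology making $F(X)$ a diffeological vector space and $X\to F(X)$, $x\mapsto[x]$, smooth. A linear subduction is a smooth linear surjection $f:W_1\to W_2$ of diffeological vector spaces such that every plot of $W_2$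 locally (near each point of its domain) lifts along $f$ to a plot of $W_1$. A diffeological vector space $V$ is projective if for every linear subduction $f:W_1\to W_2$ and every smooth linear map $g:V\to W_2$ there exists a smooth linear map $h:V\to W_1$ with $g=f\circ h$. *)

theory Defs
  imports "HOL-Analysis.Analysis" "HOL-Analysis.Finite_Function_Topology"
begin

section \<open>Smooth maps between open subsets of Euclidean spaces\<close>

text \<open>The space of dimension n is the library's \<^term>\<open>Euclidean_space n\<close>: sequences
  \<^typ>\<open>nat \<Rightarrow> real\<close> vanishing at all indices \<open>\<ge> n\<close>. This lets the dimension vary inside
  formulas. The functions below are total, but only their values on \<open>U\<close> matter.\<close>

text \<open>Class \<open>C\<^sup>k\<close> on an open set \<open>U\<close>: all partial derivatives of order at most \<open>k\<close> exist and are
  continuous on \<open>U\<close>; \<open>g\<close> is the \<open>i\<close>-th partial derivative.\<close>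

fun Ck_on :: "nat \<Rightarrow> nat \<Rightarrow> (nat \<Rightarrow> real) set \<Rightarrow> ((nat \<Rightarrow> real) \<Rightarrow> real) \<Rightarrow> bool" where
  "Ck_on 0 n U f \<longleftrightarrow> continuous_map (subtopology (Euclidean_space n) U) euclideanreal f"
| "Ck_on (Suc k) n U f \<longleftrightarrow>
     continuous_map (subtopology (Euclidean_space n) U) euclideanreal f \<and>
     (\<forall>i<n. \<exists>g. (\<forall>x\<in>U. ((\<lambda>t. f (x(i := t))) has_real_derivative g x) (at (x i))) \<and>
                Ck_on k n U g)"

definition smooth_fun :: "nat \<Rightarrow> (nat \<Rightarrow> real) set \<Rightarrow> ((nat \<Rightarrow> real) \<Rightarrow> real) \<Rightarrow> bool" where
  "smooth_fun n U f \<longleftrightarrow> (\<forall>k. Ck_on k n U f)"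

definition smooth_map :: "nat \<Rightarrow> (nat \<Rightarrow> real) set \<Rightarrow> nat \<Rightarrow> (nat \<Rightarrow> real) set \<Rightarrow>
    ((nat \<Rightarrow> real) \<Rightarrow> (nat \<Rightarrow> real)) \<Rightarrow> bool" where
  "smooth_map m V n U f \<longleftrightarrow> f \<in> V \<rightarrow> U \<and> (\<forall>j<n. smooth_fun m V (\<lambda>x. f x j))"

section \<open>Diffeological spaces\<close>

text \<open>\<open>P n U p\<close> says that the restriction of \<open>p\<close> to the open subset \<open>U\<close> of the \<open>n\<close>-dimensional
  Euclidean space is a plot; \<open>plot_cong\<close> expresses that the values of \<open>p\<close> outside \<open>U\<close> are
  irrelevant.\<close>

type_synonym 'a plots = "nat \<Rightarrow> (nat \<Rightarrow> real) set \<Rightarrow> ((nat \<Rightarrow> real) \<Rightarrow> 'a) \<Rightarrow> bool"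

locale diffeological_space =
  fixes X :: "'a set" and P :: "'a plots"
  assumes plot_open: "P n U p \<Longrightarrow> openin (Euclidean_space n) U"
    and plot_into: "P n U p \<Longrightarrow> p \<in> U \<rightarrow> X"
    and plot_cong: "P n U p \<Longrightarrow> (\<And>u. u \<in> U \<Longrightarrow> q u = p u) \<Longrightarrow> P n U q"
    and plot_const: "openin (Euclidean_space n) U \<Longrightarrow> x \<in> X \<Longrightarrow> P n U (\<lambda>_. x)"
    and plot_comp: "P n U p \<Longrightarrow> openin (Euclidean_space m) V \<Longrightarrow> smooth_map m V n U f
                    \<Longrightarrow> P m V (p \<circ> f)"
    and plot_cover: "(\<And>U. U \<in> \<U> \<Longrightarrow> P n U p) \<Longrightarrow> P n (\<Union>\<U>) p"

definition smooth_between ::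
    "'a set \<Rightarrow> 'a plots \<Rightarrow> 'b set \<Rightarrow> 'b plots \<Rightarrow> ('a \<Rightarrow> 'b) \<Rightarrow> bool" where
  "smooth_between X P Y Q f \<longleftrightarrow> f \<in> X \<rightarrow> Y \<and> (\<forall>n U p. P n U p \<longrightarrow> Q n U (f \<circ> p))"

definition real_plots :: "real plots" where
  "real_plots n U p \<longleftrightarrow> openin (Euclidean_space n) U \<and> smooth_fun n U p"

definition prod_plots :: "'a plots \<Rightarrow> 'b plots \<Rightarrow> ('a \<times> 'b) plots" where
  "prod_plots P Q n U p \<longleftrightarrow> P n U (fst \<circ> p) \<and> Q n U (snd \<circ> p)"

text \<open>The smallest diffeology on \<open>X\<close> containing the maps in \<open>G\<close>.\<close>

definition generated_plots :: "'a set \<Rightarrow> 'a plots \<Rightarrow> 'a plots" where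
  "generated_plots X G n U p \<longleftrightarrow>
     (\<forall>P. diffeological_space X P \<and> (\<forall>m V q. G m V q \<longrightarrow> P m V q) \<longrightarrow> P n U p)"

section \<open>Smooth manifolds\<close>

text \<open>A smooth manifold of dimension \<open>n\<close> without boundary, given by a (not necessarily maximal)
  smooth atlas \<open>A\<close> of charts \<open>(W, \<phi>)\<close>, where \<open>W\<close> is the domain of \<open>\<phi>\<close>.\<close>

locale smooth_manifold =
  fixes n :: nat and M :: "'a topology" and A :: "('a set \<times> ('a \<Rightarrow> nat \<Rightarrow> real)) set"
  assumes hausdorff: "Hausdorff_space M"
    and second_countable: "second_countable M"
    and chart_domain: "(W, \<phi>) \<in> A \<Longrightarrow> openin M W"
    and chart_image: "(W, \<phi>) \<in> A \<Longrightarrow> openin (Euclidean_space n) (\<phi> ` W)"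
    and chart_homeo: "(W, \<phi>) \<in> A \<Longrightarrow>
          homeomorphic_map (subtopology M W) (subtopology (Euclidean_space n) (\<phi> ` W)) \<phi>"
    and charts_cover: "topspace M = (\<Union>(W, \<phi>)\<in>A. W)"
    and charts_compatible: "(W, \<phi>) \<in> A \<Longrightarrow> (W', \<psi>) \<in> A \<Longrightarrow>
          smooth_map n (\<phi> ` (W \<inter> W')) n (\<psi> ` (W \<inter> W')) (\<psi> \<circ> inv_into W \<phi>)"

definition manifold_plots ::
    "nat \<Rightarrow> 'a topology \<Rightarrow> ('a set \<times> ('a \<Rightarrow> nat \<Rightarrow> real)) set \<Rightarrow> 'a plots" where
  "manifold_plots n M A m U p \<longleftrightarrow>
     openin (Euclidean_space m) U \<and>
     continuous_map (subtopology (Euclidean_space m) U) M p \<and>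
     (\<forall>(W, \<phi>)\<in>A. smooth_map m {u \<in> U. p u \<in> W} n (\<phi> ` W) (\<phi> \<circ> p))"

section \<open>Diffeological vector spaces\<close>

text \<open>The underlying vector space is a linear subspace \<open>V\<close> of a real vector space type.\<close>

definition diffeological_vector_space :: "'v::real_vector set \<Rightarrow> 'v plots \<Rightarrow> bool" where
  "diffeological_vector_space V P \<longleftrightarrow>
     subspace V \<and> diffeological_space V P \<and>
     smooth_between (V \<times> V) (prod_plots P P) V P (\<lambda>(x, y). x + y) \<and>
     smooth_between (UNIV \<times> V) (prod_plots real_plots P) V P (\<lambda>(r, x). r *\<^sub>R x)"

definition smooth_linear :: "'v::real_vector set \<Rightarrow> 'v plots \<Rightarrow> 'w::real_vector set \<Rightarrow> 'w plots \<Rightarrow>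
    ('v \<Rightarrow> 'w) \<Rightarrow> bool" where
  "smooth_linear V P W Q f \<longleftrightarrow>
     smooth_between V P W Q f \<and>
     (\<forall>x\<in>V. \<forall>y\<in>V. f (x + y) = f x + f y) \<and>
     (\<forall>r. \<forall>x\<in>V. f (r *\<^sub>R x) = r *\<^sub>R f x)"

definition linear_subduction :: "'v::real_vector set \<Rightarrow> 'v plots \<Rightarrow> 'w::real_vector set \<Rightarrow> 'w plots \<Rightarrow>
    ('v \<Rightarrow> 'w) \<Rightarrow> bool" where
  "linear_subduction V P W Q f \<longleftrightarrow>
     smooth_linear V P W Q f \<and> f ` V = W \<and>
     (\<forall>n U p. Q n U p \<longrightarrow>
        (\<forall>u\<in>U. \<exists>U' q. u \<in> U' \<and> U' \<subseteq> U \<and> P n U' q \<and> (\<forall>x\<in>U'. f (q x) = p x)))"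

text \<open>Types cannot be quantified inside a formula, so the types hosting the test spaces are
  parameters; a theorem with type variables in these places quantifies over all of them.\<close>

definition projective_dvs :: "'w1::real_vector itself \<Rightarrow> 'w2::real_vector itself \<Rightarrow>
    'v::real_vector set \<Rightarrow> 'v plots \<Rightarrow> bool" where
  "projective_dvs _ _ V P \<longleftrightarrow>
     diffeological_vector_space V P \<and>
     (\<forall>(W1 :: 'w1 set) P1 (W2 :: 'w2 set) P2 f g.
        diffeological_vector_space W1 P1 \<and> diffeological_vector_space W2 P2 \<and>
        linear_subduction W1 P1 W2 P2 f \<and> smooth_linear V P W2 P2 g \<longrightarrow>
        (\<exists>h. smooth_linear V P W1 P1 h \<and> (\<forall>x\<in>V. g x = f (h x))))"

section \<open>Free diffeological vector spaces\<close>

definition free_vs :: "'a set \<Rightarrow> ('a \<Rightarrow>\<^sub>0 real) set" where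
  "free_vs X = {v. Poly_Mapping.keys v \<subseteq> X}"

abbreviation free_basis :: "'a \<Rightarrow> ('a \<Rightarrow>\<^sub>0 real)" where
  "free_basis x \<equiv> Poly_Mapping.single x 1"

text \<open>The product of \<open>n\<close> factors, the \<open>i\<close>-th being the real line times an open subset \<open>U i\<close> of
  the \<open>k i\<close>-dimensional space, is an open subset of the space of dimension
  \<open>block_start k n\<close>: the coordinates \<open>(r\<^sub>i, u\<^sub>i)\<close> of the \<open>i\<close>-th factor are stored one after the
  other from position \<open>block_start k i\<close> on.\<close>

definition block_start :: "(nat \<Rightarrow> nat) \<Rightarrow> nat \<Rightarrow> nat" where
  "block_start k i = (\<Sum>j<i. Suc (k j))"

definition block_scalar :: "(nat \<Rightarrow> nat) \<Rightarrow> nat \<Rightarrow> (nat \<Rightarrow> real) \<Rightarrow> real" where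
  "block_scalar k i z = z (block_start k i)"

definition block_point :: "(nat \<Rightarrow> nat) \<Rightarrow> nat \<Rightarrow> (nat \<Rightarrow> real) \<Rightarrow> (nat \<Rightarrow> real)" where
  "block_point k i z = (\<lambda>j. if j < k i then z (Suc (block_start k i) + j) else 0)"

definition free_generators :: "'a plots \<Rightarrow> ('a \<Rightarrow>\<^sub>0 real) plots" where
  "free_generators P N D q \<longleftrightarrow>
     (\<exists>n k U p. n \<ge> 1 \<and> (\<forall>i<n. P (k i) (U i) (p i)) \<and>
        N = block_start k n \<and>
        D = {z \<in> topspace (Euclidean_space N). \<forall>i<n. block_point k i z \<in> U i} \<and>
        q = (\<lambda>z. \<Sum>i<n. block_scalar k i z *\<^sub>R free_basis (p i (block_point k i z))))"

definition free_plots :: "'a set \<Rightarrow> 'a plots \<Rightarrow> ('a \<Rightarrow>\<^sub>0 real) plots" where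
  "free_plots X P = generated_plots (free_vs X) (free_generators P)"

end

theory Submission
  imports Defs
begin

text \<open>A lift of a smooth linear map \<open>g\<close> on the free space along a linear subduction \<open>f\<close> amounts to a
  smooth map \<open>h\<close> on \<open>M\<close> with \<open>f (h x) = g [x]\<close>. In a chart \<open>x \<mapsto> g [x]\<close> becomes a plot, so it lifts
  near every point, say to \<open>h\<^sub>i\<close>. For a smooth partition of unity \<open>\<rho>\<^sub>i\<close> subordinate to the domains
  of the local lifts, linearity of \<open>f\<close> gives that \<open>h = \<Sum>\<^sub>i \<rho>\<^sub>i h\<^sub>i\<close> is a global lift. Paracompactness is not
  needed: a countable family of bump functions, which exists by the Lindelof property, is made
  locally finite by multiplying each one with cutoffs of the preceding ones.\<close>

section \<open>Calculus on open subsets of Euclidean spaces\<close>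

text \<open>The diffeology of the free space is defined as an intersection over all diffeologies
  containing the generators, which gives no hold on a single plot. Its plots are therefore
  identified as the maps that are locally finite formal sums with smooth coefficients and plots of M
  as points. Both the vector space axioms and the smoothness of a linear extension are read off from
  this formula. A local lift is controlled only on an open set S. The product of a weight with it
  continues smoothly by 0 only if the weight vanishes off a subset of S that is closed in M. Such
  supports are images of compact cubes under inverse charts, and they are closed because M is
  Hausdorff. For bumps b_i, the weights before normalisation are the products of b_i with the
  cutoffs of 1/(i+1) - b_j for j < i. The thresholds 1/(i+1) serve two aims. They fall below every
  positive bound, so late terms vanish near any point where some b_j is positive. They are
  themselves positive, so the first bump that is nonzero at a point survives there and the total
  never vanishes.\<close>

lemma Euclidean_space_eq_top_of_set: "Euclidean_space n = top_of_set {x. \<forall>i\<ge>n. x i = 0}"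
  by (simp add: Euclidean_space_def euclidean_product_topology)

lemma openin_Euclidean_space_subset:
  "openin (Euclidean_space n) U \<Longrightarrow> x \<in> U \<Longrightarrow> n \<le> i \<Longrightarrow> x i = 0"
  using openin_subset[of "Euclidean_space n" U] by (auto simp: topspace_Euclidean_space)

lemma subtopology_Euclidean_space_openin:
  assumes "openin (Euclidean_space n) U"
  shows "subtopology (Euclidean_space n) U = top_of_set U"
  using openin_subset[OF assms]
  by (simp add: Euclidean_space_eq_top_of_set subtopology_subtopology Int_absorb1)

lemma openin_Euclidean_space_preimage:
  assumes "openin (Euclidean_space n) U" "continuous_on U f" "open T"
  shows "openin (Euclidean_space n) {x \<in> U. f x \<in> T}"
proof -
  have "openin (top_of_set U) (U \<inter> f -` T)"
    using assms(2,3) continuous_openin_preimage_gen by blast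
  moreover have "U \<inter> f -` T = {x \<in> U. f x \<in> T}" by auto
  ultimately show ?thesis
    using openin_trans[of U _ "{x. \<forall>i\<ge>n. x i = 0}"] assms(1)
    by (simp add: Euclidean_space_eq_top_of_set)
qed

text \<open>A partial derivative in direction \<open>i\<close> sees only the line
  \<open>x(i := t)\<close>. The bound \<open>i < n\<close> keeps this line inside the Euclidean
  space, so it stays in the relatively open \<open>U\<close> for \<open>t\<close> near
  \<open>x i\<close>.\<close>

lemma openin_Euclidean_space_update:
  assumes U: "openin (Euclidean_space n) U" and x: "x \<in> U" and i: "i < n"
  shows "eventually (\<lambda>t. x(i := t) \<in> U) (nhds (x i))"
proof -
  obtain T where T: "open T" "U = {x. \<forall>i\<ge>n. x i = 0} \<inter> T"
    using U unfolding Euclidean_space_eq_top_of_set openin_open by auto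
  have "continuous_on UNIV (\<lambda>t::real. x(i := t))"
  proof (rule continuous_on_coordinatewise_then_product)
    show "continuous_on UNIV (\<lambda>t. (x(i := t)) j)" for j
      by (cases "j = i") auto
  qed
  then have "open ((\<lambda>t. x(i := t)) -` T)"
    using T(1) open_vimage by blast
  moreover have "x i \<in> (\<lambda>t. x(i := t)) -` T" using x T by auto
  ultimately have "eventually (\<lambda>t. t \<in> (\<lambda>t. x(i := t)) -` T) (nhds (x i))"
    by (rule eventually_nhds_in_open)
  then show ?thesis
    by eventually_elim (use x i T in auto)
qed

text \<open>In a basic open set of the infinite product every coordinate has its own radius. From
  \<open>n\<close> on both points have coordinate 0, so only finitely many radii matter and their
  minimum works.\<close>

lemma openin_Euclidean_space_box:
  assumes U: "openin (Euclidean_space n) U" and a: "a \<in> U"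
  obtains e where "e > 0"
    "\<And>x. (\<And>j. j \<ge> n \<Longrightarrow> x j = 0) \<Longrightarrow> (\<And>j. j < n \<Longrightarrow> \<bar>x j - a j\<bar> < e) \<Longrightarrow> x \<in> U"
proof -
  obtain T where T: "open T" "U = {x. \<forall>i\<ge>n. x i = 0} \<inter> T"
    using U unfolding Euclidean_space_eq_top_of_set openin_open by auto
  have "openin (product_topology (\<lambda>_. euclideanreal) UNIV) T"
    using T(1) by (simp add: euclidean_product_topology)
  moreover have "a \<in> T" using a T by auto
  ultimately obtain B where B: "\<And>i::nat. open (B i)" "a \<in> Pi\<^sub>E UNIV B" "Pi\<^sub>E UNIV B \<subseteq> T"
    unfolding openin_product_topology_alt by (simp, meson)
  have "\<exists>e>0. \<forall>y. \<bar>y - a j\<bar> < e \<longrightarrow> y \<in> B j" for j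
    using B(1)[of j] B(2) unfolding open_dist by (auto simp: dist_real_def)
  then obtain e where e: "\<And>j. e j > 0" "\<And>j y. \<bar>y - a j\<bar> < e j \<Longrightarrow> y \<in> B j"
    by metis
  \<comment> \<open>The entry 1 keeps the set nonempty when \<open>n = 0\<close>.\<close>
  define d where "d = Min (insert 1 (e ` {..<n}))"
  show ?thesis
  proof
    show "d > 0" using e(1) by (auto simp: d_def)
    fix x assume x: "\<And>j. j \<ge> n \<Longrightarrow> x j = 0" "\<And>j. j < n \<Longrightarrow> \<bar>x j - a j\<bar> < d"
    have "x j \<in> B j" for j
    proof (cases "j < n")
      case True
      then have "d \<le> e j" by (auto simp: d_def)
      then show ?thesis using x(2)[OF True] e(2) by auto
    next
      case False
      then have "x j = a j" using x(1) a T(2) by auto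
      then show ?thesis using B(2) by auto
    qed
    then show "x \<in> U" using x(1) B(3) T(2) by auto
  qed
qed

text \<open>Tychonoff for a product of closed intervals and copies of \<open>{0}\<close>.\<close>

lemma compact_Euclidean_box:
  "compact {y::nat \<Rightarrow> real. (\<forall>j\<ge>n. y j = 0) \<and> (\<forall>j<n. \<bar>y j - a j\<bar> \<le> d)}"
proof -
  let ?B = "\<lambda>j. if j < n then {a j - d..a j + d} else {0}"
  have "compactin (product_topology (\<lambda>_. euclideanreal) UNIV) (Pi\<^sub>E UNIV ?B)"
    by (subst compactin_PiE) auto
  moreover have "Pi\<^sub>E UNIV ?B = {y. (\<forall>j\<ge>n. y j = 0) \<and> (\<forall>j<n. \<bar>y j - a j\<bar> \<le> d)}"
  proof (intro set_eqI iffI)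
    fix y assume y: "y \<in> Pi\<^sub>E UNIV ?B"
    have "y j \<in> ?B j" for j using y by blast
    then have "y j = 0" if "j \<ge> n" for j
      using that by (metis not_less singletonD)
    moreover have "\<bar>y j - a j\<bar> \<le> d" if "j < n" for j
      using \<open>y j \<in> ?B j\<close> that by (auto simp: abs_le_iff)
    ultimately show "y \<in> {y. (\<forall>j\<ge>n. y j = 0) \<and> (\<forall>j<n. \<bar>y j - a j\<bar> \<le> d)}" by blast
  qed (auto simp: abs_le_iff)
  ultimately show ?thesis by (simp add: euclidean_product_topology)
qed

section \<open>Functions of class \<open>Ck_on\<close>: locality, gluing and algebra\<close>

lemma Ck_on_imp_continuous_on:
  assumes "openin (Euclidean_space n) U" "Ck_on k n U f"
  shows "continuous_on U f"
  using assms(2) by (cases k) (auto simp: subtopology_Euclidean_space_openin[OF assms(1)])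

lemma Ck_on_0:
  "openin (Euclidean_space n) U \<Longrightarrow> Ck_on 0 n U f \<longleftrightarrow> continuous_on U f"
  by (simp add: subtopology_Euclidean_space_openin)

lemma Ck_on_SucE:
  assumes "Ck_on (Suc k) n U f"
  obtains g where
    "\<And>i x. i < n \<Longrightarrow> x \<in> U \<Longrightarrow> ((\<lambda>t. f (x(i := t))) has_real_derivative g i x) (at (x i))"
    "\<And>i. i < n \<Longrightarrow> Ck_on k n U (g i)"
  using assms by (simp, metis)

lemma Ck_on_SucI:
  assumes "openin (Euclidean_space n) U" "continuous_on U f"
    "\<And>i x. i < n \<Longrightarrow> x \<in> U \<Longrightarrow> ((\<lambda>t. f (x(i := t))) has_real_derivative g i x) (at (x i))"
    "\<And>i. i < n \<Longrightarrow> Ck_on k n U (g i)"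
  shows "Ck_on (Suc k) n U f"
  using assms by (auto simp: subtopology_Euclidean_space_openin[OF assms(1)])

declare Ck_on.simps [simp del]

lemma Ck_on_SucD:
  assumes U: "openin (Euclidean_space n) U"
  shows "Ck_on (Suc k) n U f \<Longrightarrow> Ck_on k n U f"
proof (induction k arbitrary: f)
  case 0
  then show ?case using Ck_on_imp_continuous_on[OF U] Ck_on_0[OF U] by blast
next
  case (Suc k)
  from Ck_on_SucE[OF Suc.prems] obtain g where g:
    "\<And>i x. i < n \<Longrightarrow> x \<in> U \<Longrightarrow> ((\<lambda>t. f (x(i := t))) has_real_derivative g i x) (at (x i))"
    "\<And>i. i < n \<Longrightarrow> Ck_on (Suc k) n U (g i)" by metis
  show ?case
    by (rule Ck_on_SucI[OF U Ck_on_imp_continuous_on[OF U Suc.prems] g(1) Suc.IH[OF g(2)]])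
qed

text \<open>The derivatives in \<^const>\<open>Ck_on\<close> look at points outside \<open>U\<close>, so this needs \<open>U\<close> open.\<close>

lemma Ck_on_cong:
  assumes U: "openin (Euclidean_space n) U"
  shows "Ck_on k n U f \<Longrightarrow> (\<And>x. x \<in> U \<Longrightarrow> f' x = f x) \<Longrightarrow> Ck_on k n U f'"
proof (induction k arbitrary: f f')
  case 0
  then show ?case unfolding Ck_on_0[OF U] using continuous_on_cong[OF refl, of U f' f] by simp
next
  case (Suc k)
  from Ck_on_SucE[OF Suc.prems(1)] obtain g where g:
    "\<And>i x. i < n \<Longrightarrow> x \<in> U \<Longrightarrow> ((\<lambda>t. f (x(i := t))) has_real_derivative g i x) (at (x i))"
    "\<And>i. i < n \<Longrightarrow> Ck_on k n U (g i)" by metis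
  have "continuous_on U f'"
    using Ck_on_imp_continuous_on[OF U Suc.prems(1)] continuous_on_cong[OF refl, of U f' f] Suc.prems(2)
    by simp
  moreover have "((\<lambda>t. f' (x(i := t))) has_real_derivative g i x) (at (x i))"
    if "i < n" "x \<in> U" for i x
  proof -
    have "eventually (\<lambda>t. f' (x(i := t)) = f (x(i := t))) (nhds (x i))"
      using openin_Euclidean_space_update[OF U that(2,1)]
      by eventually_elim (rule Suc.prems(2))
    from DERIV_cong_ev[OF refl this refl] g(1)[OF that] show ?thesis by blast
  qed
  ultimately show ?case using g(2) by (intro Ck_on_SucI[OF U])
qed

lemma Ck_on_subset:
  assumes V: "openin (Euclidean_space n) V" and VU: "V \<subseteq> U" and U: "openin (Euclidean_space n) U"
  shows "Ck_on k n U f \<Longrightarrow> Ck_on k n V f"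
proof (induction k arbitrary: f)
  case 0
  then show ?case using VU by (auto simp: Ck_on_0[OF U] Ck_on_0[OF V] intro: continuous_on_subset)
next
  case (Suc k)
  from Ck_on_SucE[OF Suc.prems(1)] obtain g where g:
    "\<And>i x. i < n \<Longrightarrow> x \<in> U \<Longrightarrow> ((\<lambda>t. f (x(i := t))) has_real_derivative g i x) (at (x i))"
    "\<And>i. i < n \<Longrightarrow> Ck_on k n U (g i)" by metis
  have "continuous_on V f"
    using Ck_on_imp_continuous_on[OF U Suc.prems(1)] VU by (auto intro: continuous_on_subset)
  then show ?case
    by (rule Ck_on_SucI[OF V _ g(1)[OF _ subsetD[OF VU]] Suc.IH[OF g(2)]])
qed

lemma continuous_on_Union_openin_Euclidean_space:
  assumes \<U>: "\<And>U. U \<in> \<U> \<Longrightarrow> openin (Euclidean_space n) U"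
    and f: "\<And>U. U \<in> \<U> \<Longrightarrow> continuous_on U f"
  shows "continuous_on (\<Union>\<U>) f"
proof -
  have UU: "openin (Euclidean_space n) (\<Union>\<U>)" using \<U> by (rule openin_Union)
  have "continuous_map (top_of_set (\<Union>\<U>)) euclidean f"
  proof (rule pasting_lemma[where T = "\<lambda>U. U" and I = \<U> and f = "\<lambda>_. f"])
    fix U assume U: "U \<in> \<U>"
    then show "openin (top_of_set (\<Union>\<U>)) U"
      using \<U>[OF U] openin_subset[OF UU]
      by (auto simp: Euclidean_space_eq_top_of_set intro: openin_subset_trans)
    have "(\<Union>\<U>) \<inter> U = U" using U by auto
    then show "continuous_map (subtopology (top_of_set (\<Union>\<U>)) U) euclidean f"
      using f[OF U] by (simp add: subtopology_subtopology)
  qed auto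
  then show ?thesis by simp
qed

lemma Ck_on_Union:
  assumes \<U>: "\<And>U. U \<in> \<U> \<Longrightarrow> openin (Euclidean_space n) U"
  shows "(\<And>U. U \<in> \<U> \<Longrightarrow> Ck_on k n U f) \<Longrightarrow> Ck_on k n (\<Union>\<U>) f"
proof (induction k arbitrary: f)
  case 0
  have UU: "openin (Euclidean_space n) (\<Union>\<U>)" using \<U> by (rule openin_Union)
  show ?case
    unfolding Ck_on_0[OF UU] using 0 \<U> Ck_on_imp_continuous_on
    by (blast intro: continuous_on_Union_openin_Euclidean_space)
next
  case (Suc k)
  have UU: "openin (Euclidean_space n) (\<Union>\<U>)" using \<U> by (rule openin_Union)
  \<comment> \<open>Each member of the cover comes with its own partial derivatives.
    \<open>deriv\<close> gives one function for all members, and it equals the local ones by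
    uniqueness of derivatives.\<close>
  define g where "g = (\<lambda>i x. deriv (\<lambda>t. f (x(i := t))) (x i))"
  have g: "((\<lambda>t. f (x(i := t))) has_real_derivative g i x) (at (x i))"
    if "i < n" "x \<in> U" "U \<in> \<U>" for i x U
    using Ck_on_SucE[OF Suc.prems[OF that(3)]] that(1,2)
    unfolding g_def by (metis DERIV_imp_deriv)
  show ?case
  proof (rule Ck_on_SucI[OF UU])
    show "continuous_on (\<Union>\<U>) f"
      using Suc.prems \<U> Ck_on_imp_continuous_on
      by (blast intro: continuous_on_Union_openin_Euclidean_space)
    show "((\<lambda>t. f (x(i := t))) has_real_derivative g i x) (at (x i))"
      if "i < n" "x \<in> \<Union>\<U>" for i x
      using g that by blast
    show "Ck_on k n (\<Union>\<U>) (g i)" if i: "i < n" for i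
    proof (rule Suc.IH)
      fix U assume U: "U \<in> \<U>"
      obtain g' where g':
        "\<And>i x. i < n \<Longrightarrow> x \<in> U \<Longrightarrow> ((\<lambda>t. f (x(i := t))) has_real_derivative g' i x) (at (x i))"
        "\<And>i. i < n \<Longrightarrow> Ck_on k n U (g' i)"
        using Ck_on_SucE[OF Suc.prems[OF U]] by metis
      show "Ck_on k n U (g i)"
        by (rule Ck_on_cong[OF \<U>[OF U] g'(2)[OF i]]) (use g g'(1) i U DERIV_unique in blast)
    qed
  qed
qed

lemma Ck_on_const:
  assumes U: "openin (Euclidean_space n) U"
  shows "Ck_on k n U (\<lambda>_. c)"
proof (induction k arbitrary: c)
  case 0
  then show ?case by (simp add: Ck_on_0[OF U])
next
  case (Suc k)
  show ?case by (rule Ck_on_SucI[OF U, where g = "\<lambda>_ _. 0"]) (auto intro: Suc)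
qed

lemma Ck_on_coordinate:
  assumes U: "openin (Euclidean_space n) U"
  shows "Ck_on k n U (\<lambda>x. x j)"
proof (cases k)
  case 0
  have "continuous_on U (\<lambda>x. x j)"
    by (rule continuous_on_subset[OF continuous_on_product_coordinates]) simp
  with 0 show ?thesis by (simp add: Ck_on_0[OF U])
next
  case (Suc l)
  have "continuous_on U (\<lambda>x. x j)"
    by (rule continuous_on_subset[OF continuous_on_product_coordinates]) simp
  moreover have "((\<lambda>t. (x(i := t)) j) has_real_derivative (if i = j then 1 else 0)) (at (x i))"
    for i x by (cases "i = j") auto
  ultimately show ?thesis
    unfolding Suc by (intro Ck_on_SucI[OF U, where g = "\<lambda>i _. if i = j then 1 else 0"] Ck_on_const[OF U])
qed

lemma Ck_on_add:
  assumes U: "openin (Euclidean_space n) U"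
  shows "Ck_on k n U f \<Longrightarrow> Ck_on k n U g \<Longrightarrow> Ck_on k n U (\<lambda>x. f x + g x)"
proof (induction k arbitrary: f g)
  case 0
  then show ?case by (simp add: Ck_on_0[OF U] continuous_on_add)
next
  case (Suc k)
  from Ck_on_SucE[OF Suc.prems(1)] obtain f' where f':
    "\<And>i x. i < n \<Longrightarrow> x \<in> U \<Longrightarrow> ((\<lambda>t. f (x(i := t))) has_real_derivative f' i x) (at (x i))"
    "\<And>i. i < n \<Longrightarrow> Ck_on k n U (f' i)" by metis
  from Ck_on_SucE[OF Suc.prems(2)] obtain g' where g':
    "\<And>i x. i < n \<Longrightarrow> x \<in> U \<Longrightarrow> ((\<lambda>t. g (x(i := t))) has_real_derivative g' i x) (at (x i))"
    "\<And>i. i < n \<Longrightarrow> Ck_on k n U (g' i)" by metis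
  show ?case
  proof (rule Ck_on_SucI[OF U, where g = "\<lambda>i x. f' i x + g' i x"])
    show "continuous_on U (\<lambda>x. f x + g x)"
      by (intro continuous_on_add Suc.prems[THEN Ck_on_imp_continuous_on[OF U]])
  qed (rule DERIV_add[OF f'(1) g'(1)] Suc.IH[OF f'(2) g'(2)]; assumption)+
qed

lemma Ck_on_mult:
  assumes U: "openin (Euclidean_space n) U"
  shows "Ck_on k n U f \<Longrightarrow> Ck_on k n U g \<Longrightarrow> Ck_on k n U (\<lambda>x. f x * g x)"
proof (induction k arbitrary: f g)
  case 0
  then show ?case by (simp add: Ck_on_0[OF U] continuous_on_mult)
next
  case (Suc k)
  from Ck_on_SucE[OF Suc.prems(1)] obtain f' where f':
    "\<And>i x. i < n \<Longrightarrow> x \<in> U \<Longrightarrow> ((\<lambda>t. f (x(i := t))) has_real_derivative f' i x) (at (x i))"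
    "\<And>i. i < n \<Longrightarrow> Ck_on k n U (f' i)" by metis
  from Ck_on_SucE[OF Suc.prems(2)] obtain g' where g':
    "\<And>i x. i < n \<Longrightarrow> x \<in> U \<Longrightarrow> ((\<lambda>t. g (x(i := t))) has_real_derivative g' i x) (at (x i))"
    "\<And>i. i < n \<Longrightarrow> Ck_on k n U (g' i)" by metis
  show ?case
  proof (rule Ck_on_SucI[OF U, where g = "\<lambda>i x. f' i x * g x + g' i x * f x"])
    show "((\<lambda>t. f (x(i := t)) * g (x(i := t))) has_real_derivative f' i x * g x + g' i x * f x) (at (x i))"
      if "i < n" "x \<in> U" for i x
      using DERIV_mult[OF f'(1)[OF that] g'(1)[OF that]] by simp
    show "continuous_on U (\<lambda>x. f x * g x)"
      by (intro continuous_on_mult Suc.prems[THEN Ck_on_imp_continuous_on[OF U]])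
    \<comment> \<open>In each product one factor is a derivative, of class \<open>k\<close>, and the
      other an original function, of class \<open>Suc k\<close>, which is lowered to
      \<open>k\<close>.\<close>
    show "Ck_on k n U (\<lambda>x. f' i x * g x + g' i x * f x)" if i: "i < n" for i
      by (rule Ck_on_add[OF U Suc.IH[OF f'(2)[OF i] Ck_on_SucD[OF U Suc.prems(2)]]
            Suc.IH[OF g'(2)[OF i] Ck_on_SucD[OF U Suc.prems(1)]]])
  qed
qed

lemma Ck_on_sum:
  assumes U: "openin (Euclidean_space n) U"
  shows "(\<And>i. i \<in> I \<Longrightarrow> Ck_on k n U (f i)) \<Longrightarrow> Ck_on k n U (\<lambda>x. \<Sum>i\<in>I. f i x)"
  by (induction I rule: infinite_finite_induct) (simp_all add: Ck_on_const[OF U] Ck_on_add[OF U])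

lemma Ck_on_inverse:
  assumes U: "openin (Euclidean_space n) U"
  shows "Ck_on k n U f \<Longrightarrow> (\<And>x. x \<in> U \<Longrightarrow> f x \<noteq> 0) \<Longrightarrow> Ck_on k n U (\<lambda>x. inverse (f x))"
proof (induction k arbitrary: f)
  case 0
  then show ?case by (simp add: Ck_on_0[OF U] continuous_on_inverse)
next
  case (Suc k)
  from Ck_on_SucE[OF Suc.prems(1)] obtain f' where f':
    "\<And>i x. i < n \<Longrightarrow> x \<in> U \<Longrightarrow> ((\<lambda>t. f (x(i := t))) has_real_derivative f' i x) (at (x i))"
    "\<And>i. i < n \<Longrightarrow> Ck_on k n U (f' i)" by metis
  \<comment> \<open>The derivative of the reciprocal contains the reciprocal itself, so its class
    \<open>k\<close> is taken from the induction hypothesis first; products do the rest.\<close>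
  have *: "Ck_on k n U (\<lambda>x. inverse (f x))"
    using Suc.IH Suc.prems Ck_on_SucD[OF U] by blast
  show ?case
  proof (rule Ck_on_SucI[OF U, where g = "\<lambda>i x. (- 1) * (inverse (f x) * f' i x * inverse (f x))"])
    show "((\<lambda>t. inverse (f (x(i := t)))) has_real_derivative
        (- 1) * (inverse (f x) * f' i x * inverse (f x))) (at (x i))"
      if "i < n" "x \<in> U" for i x
      using DERIV_inverse'[OF f'(1)[OF that]] Suc.prems(2)[OF that(2)] by simp
    show "continuous_on U (\<lambda>x. inverse (f x))"
      using Ck_on_imp_continuous_on[OF U *] .
    show "Ck_on k n U (\<lambda>x. (- 1) * (inverse (f x) * f' i x * inverse (f x)))" if "i < n" for i
      by (intro Ck_on_mult[OF U] Ck_on_const[OF U] * f'(2)[OF that])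
  qed
qed

section \<open>The chain rule and flat cutoff functions\<close>

lemma tendsto_fun_componentwise:
  fixes f :: "'a \<Rightarrow> 'i \<Rightarrow> 'b::topological_space"
  assumes "\<And>j. ((\<lambda>t. f t j) \<longlongrightarrow> l j) F"
  shows "(f \<longlongrightarrow> l) F"
proof -
  have "limitin (product_topology (\<lambda>_. euclidean) UNIV) f l F"
    using assms by (subst limitin_componentwise) auto
  then show ?thesis by (simp add: euclidean_product_topology)
qed

text \<open>The chain rule along a curve: the increment of \<open>r\<close> is split into increments in one coordinate
  at a time, and the mean value theorem turns each into a value of a continuous partial
  derivative.\<close>

lemma chain_rule_partial_derivatives:
  fixes c :: "real \<Rightarrow> nat \<Rightarrow> real"
  assumes U: "openin (Euclidean_space n) U" and cU: "eventually (\<lambda>t. c t \<in> U) (nhds t0)"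
    and c: "\<And>j. j < n \<Longrightarrow> ((\<lambda>t. c t j) has_real_derivative v j) (at t0)"
    and r: "\<And>j x. j < n \<Longrightarrow> x \<in> U \<Longrightarrow> ((\<lambda>t. r (x(j := t))) has_real_derivative d j x) (at (x j))"
    and d: "\<And>j. j < n \<Longrightarrow> continuous_on U (d j)"
  shows "((\<lambda>t. r (c t)) has_real_derivative (\<Sum>j<n. d j (c t0) * v j)) (at t0)"
proof -
  define a where "a = c t0"
  \<comment> \<open>A staircase from \<open>a\<close> to \<open>c t\<close>: \<open>m 0 t\<close> is
    \<open>a\<close>, each step moves one coordinate, and \<open>m n t\<close> is \<open>c t\<close>
    whenever \<open>c t\<close> lies in \<open>U\<close>.\<close>
  define m where "m k t = (\<lambda>j. if j < k then c t j else a j)" for k t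
  have aU: "a \<in> U" unfolding a_def using cU by (rule eventually_nhds_x_imp_x)
  have ctend: "((\<lambda>t. c t j) \<longlongrightarrow> a j) (at t0)" if "j < n" for j
    using DERIV_isCont[OF c[OF that]] by (simp add: a_def isCont_def)
  \<comment> \<open>The staircase points may leave \<open>U\<close> even if \<open>c t\<close> lies
    in it. Within a box around \<open>a\<close> inside \<open>U\<close> they cannot.\<close>
  obtain e where e: "e > 0"
    "\<And>x. (\<And>j. j \<ge> n \<Longrightarrow> x j = 0) \<Longrightarrow> (\<And>j. j < n \<Longrightarrow> \<bar>x j - a j\<bar> < e) \<Longrightarrow> x \<in> U"
    using openin_Euclidean_space_box[OF U aU] by metis
  have near: "eventually (\<lambda>t. \<forall>j<n. \<bar>c t j - a j\<bar> < e) (at t0)"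
  proof -
    have "eventually (\<lambda>t. \<forall>j\<in>{..<n}. dist (c t j) (a j) < e) (at t0)"
      by (rule eventually_ball_finite) (use e(1) ctend tendstoD in \<open>simp, blast\<close>)
    then show ?thesis by (simp add: dist_real_def Ball_def)
  qed
  have step: "\<exists>\<xi>\<in>U. (\<forall>j. \<bar>\<xi> j - a j\<bar> \<le> \<bar>c t j - a j\<bar>) \<and>
      r (m (Suc k) t) - r (m k t) = d k \<xi> * (c t k - a k)"
    if t: "\<forall>j<n. \<bar>c t j - a j\<bar> < e" and k: "k < n" for k t
  proof -
    have inU: "(m k t)(k := s) \<in> U" if "\<bar>s - a k\<bar> \<le> \<bar>c t k - a k\<bar>" for s
    proof (rule e(2))
      show "((m k t)(k := s)) j = 0" if "j \<ge> n" for j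
        using that k openin_Euclidean_space_subset[OF U aU that] by (auto simp: m_def)
      show "\<bar>((m k t)(k := s)) j - a j\<bar> < e" if "j < n" for j
        using that k t e(1) \<open>\<bar>s - a k\<bar> \<le> _\<close> by (auto simp: m_def intro: le_less_trans)
    qed
    have bd: "\<bar>((m k t)(k := s)) j - a j\<bar> \<le> \<bar>c t j - a j\<bar>" if "\<bar>s - a k\<bar> \<le> \<bar>c t k - a k\<bar>" for s j
      using that by (auto simp: m_def)
    have m1: "m (Suc k) t = (m k t)(k := c t k)" and m0: "m k t = (m k t)(k := a k)"
      by (auto simp: m_def fun_eq_iff)
    have der: "((\<lambda>s. r ((m k t)(k := s))) has_real_derivative d k ((m k t)(k := s))) (at s)"
      if "\<bar>s - a k\<bar> \<le> \<bar>c t k - a k\<bar>" for s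
      using r[OF k inU[OF that]] by simp
    consider "a k < c t k" | "c t k < a k" | "c t k = a k" by linarith
    then show ?thesis
    proof cases
      case 1
      then obtain z where z: "a k < z" "z < c t k"
        "r ((m k t)(k := c t k)) - r ((m k t)(k := a k)) = (c t k - a k) * d k ((m k t)(k := z))"
        using MVT2[OF 1, of "\<lambda>s. r ((m k t)(k := s))" "\<lambda>s. d k ((m k t)(k := s))"] der by auto
      then show ?thesis using inU[of z] bd[of z] 1 m1 m0 by (intro bexI[of _ "(m k t)(k := z)"]) auto
    next
      case 2
      then obtain z where z: "c t k < z" "z < a k"
        "r ((m k t)(k := a k)) - r ((m k t)(k := c t k)) = (a k - c t k) * d k ((m k t)(k := z))"
        using MVT2[OF 2, of "\<lambda>s. r ((m k t)(k := s))" "\<lambda>s. d k ((m k t)(k := s))"] der by auto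
      then show ?thesis using inU[of z] bd[of z] 2 m1 m0
        by (intro bexI[of _ "(m k t)(k := z)"]) (auto simp: algebra_simps)
    next
      case 3
      then show ?thesis using inU[of "a k"] bd[of "a k"] m1 m0
        by (intro bexI[of _ "(m k t)(k := a k)"]) auto
    qed
  qed
  have "((\<lambda>t. r (m k t)) has_real_derivative (\<Sum>j<k. d j a * v j)) (at t0)" if "k \<le> n" for k
    using that
  proof (induction k)
    case 0
    have "m 0 = (\<lambda>_. a)" by (auto simp: m_def fun_eq_iff)
    then show ?case by simp
  next
    case (Suc k)
    then have k: "k < n" by simp
    \<comment> \<open>The mean value point, chosen for each \<open>t\<close>. In every coordinate it
      is no farther from \<open>a\<close> than \<open>c t\<close>, so it tends to \<open>a\<close>;
      for \<open>t\<close> away from \<open>t0\<close> its value may be arbitrary.\<close>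
    define \<xi> where "\<xi> t = (SOME \<xi>. \<xi> \<in> U \<and> (\<forall>j. \<bar>\<xi> j - a j\<bar> \<le> \<bar>c t j - a j\<bar>) \<and>
      r (m (Suc k) t) - r (m k t) = d k \<xi> * (c t k - a k))" for t
    have \<xi>: "eventually (\<lambda>t. \<xi> t \<in> U \<and> (\<forall>j. \<bar>\<xi> t j - a j\<bar> \<le> \<bar>c t j - a j\<bar>) \<and>
      r (m (Suc k) t) - r (m k t) = d k (\<xi> t) * (c t k - a k)) (at t0)"
      using near
    proof eventually_elim
      case (elim t)
      then show ?case using someI_ex[OF step[OF elim k, unfolded Bex_def]] unfolding \<xi>_def by blast
    qed
    have "((\<lambda>t. \<xi> t j) \<longlongrightarrow> a j) (at t0)" for j
    proof (cases "j < n")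
      case True
      have "((\<lambda>t. \<bar>c t j - a j\<bar>) \<longlongrightarrow> 0) (at t0)"
        using ctend[OF True] by (simp add: tendsto_rabs_zero_iff LIM_zero_iff)
      then have "((\<lambda>t. \<xi> t j - a j) \<longlongrightarrow> 0) (at t0)"
        by (rule Lim_null_comparison[rotated]) (use \<xi> in eventually_elim, simp)
      then show ?thesis by (simp add: LIM_zero_iff)
    next
      case False
      then have "x j = a j" if "x \<in> U" for x
        using openin_Euclidean_space_subset[OF U that] openin_Euclidean_space_subset[OF U aU] by simp
      then have "eventually (\<lambda>t. \<xi> t j = a j) (at t0)"
        using \<xi> by (blast intro: eventually_mono)
      then show ?thesis by (rule tendsto_eventually)
    qed
    then have "(\<xi> \<longlongrightarrow> a) (at t0)"
      by (rule tendsto_fun_componentwise)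
    then have "((\<lambda>t. d k (\<xi> t)) \<longlongrightarrow> d k a) (at t0)"
      by (rule continuous_on_tendsto_compose[OF d[OF k] _ aU]) (use \<xi> in \<open>auto elim: eventually_mono\<close>)
    moreover have "((\<lambda>t. (c t k - a k) / (t - t0)) \<longlongrightarrow> v k) (at t0)"
      using c[OF k] unfolding has_field_derivative_iff by (simp add: a_def)
    ultimately have "((\<lambda>t. d k (\<xi> t) * ((c t k - a k) / (t - t0))) \<longlongrightarrow> d k a * v k) (at t0)"
      by (rule tendsto_mult)
    moreover have "eventually (\<lambda>t. d k (\<xi> t) * ((c t k - a k) / (t - t0)) =
        ((r (m (Suc k) t) - r (m k t)) - (r (m (Suc k) t0) - r (m k t0))) / (t - t0)) (at t0)"
    proof -
      \<comment> \<open>At \<open>t0\<close> both staircase points are \<open>a\<close>, so the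
        subtracted term of the difference quotient vanishes.\<close>
      have "m (Suc k) t0 = m k t0" by (auto simp: m_def a_def)
      then show ?thesis using \<xi> by (auto elim: eventually_mono)
    qed
    ultimately have "((\<lambda>t. r (m (Suc k) t) - r (m k t)) has_real_derivative d k a * v k) (at t0)"
      unfolding has_field_derivative_iff by (rule Lim_transform_eventually)
    from DERIV_add[OF this Suc.IH] k show ?case by (simp add: add.commute)
  qed
  from this[of n] have "((\<lambda>t. r (m n t)) has_real_derivative (\<Sum>j<n. d j a * v j)) (at t0)" by simp
  moreover have "eventually (\<lambda>t. r (m n t) = r (c t)) (nhds t0)"
    using cU
  proof eventually_elim
    case (elim t)
    have "m n t j = c t j" for j
      using openin_Euclidean_space_subset[OF U elim, of j] openin_Euclidean_space_subset[OF U aU, of j]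
      by (simp add: m_def)
    then have "m n t = c t" by blast
    then show ?case by simp
  qed
  ultimately show ?thesis
    by (simp add: DERIV_cong_ev[OF refl _ refl] a_def)
qed

text \<open>The partial derivatives of the composite are sums of products of
  \<open>d j \<circ> F\<close> with derivatives of the coordinates of \<open>F\<close>. Since
  \<open>d j \<circ> F\<close> is again a composite with the same inner map, the induction keeps
  \<open>F\<close> fixed and generalises \<open>r\<close>.\<close>

lemma Ck_on_compose:
  assumes U: "openin (Euclidean_space n) U" and V: "openin (Euclidean_space m) V"
    and F: "F \<in> V \<rightarrow> U"
  shows "Ck_on k n U r \<Longrightarrow> (\<And>j. j < n \<Longrightarrow> Ck_on k m V (\<lambda>x. F x j)) \<Longrightarrow> Ck_on k m V (\<lambda>x. r (F x))"
proof (induction k arbitrary: r)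
  have cont: "continuous_on V (\<lambda>x. r (F x))"
    if "continuous_on U r" "\<And>j. j < n \<Longrightarrow> continuous_on V (\<lambda>x. F x j)" for r
  proof -
    \<comment> \<open>The assumption covers only the coordinates below \<open>n\<close>; the others
      vanish because \<open>F\<close> has values in \<open>U\<close>.\<close>
    have "continuous_on V (\<lambda>x. F x j)" for j
    proof (cases "j < n")
      case False
      then have "continuous_on V (\<lambda>x. F x j) \<longleftrightarrow> continuous_on V (\<lambda>_. 0 :: real)"
        using openin_Euclidean_space_subset[OF U funcset_mem[OF F]] by (intro continuous_on_cong) auto
      then show ?thesis by simp
    qed (use that in auto)
    then have "continuous_on V F" by (rule continuous_on_coordinatewise_then_product)
    then show ?thesis
      using continuous_on_compose2[OF that(1)] F by auto
  qed
  {
    case 0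
    then show ?case using cont by (simp add: Ck_on_0[OF U] Ck_on_0[OF V])
  next
    case (Suc k)
    from Ck_on_SucE[OF Suc.prems(1)] obtain d where d:
      "\<And>i x. i < n \<Longrightarrow> x \<in> U \<Longrightarrow> ((\<lambda>t. r (x(i := t))) has_real_derivative d i x) (at (x i))"
      "\<And>i. i < n \<Longrightarrow> Ck_on k n U (d i)" by metis
    have "\<exists>g. (\<forall>i<m. \<forall>x\<in>V. ((\<lambda>t. F (x(i := t)) j) has_real_derivative g i x) (at (x i))) \<and>
        (\<forall>i<m. Ck_on k m V (g i))" if "j < n" for j
      by (rule Ck_on_SucE[OF Suc.prems(2)[OF that]]) blast
    then have "\<exists>v. \<forall>j<n. (\<forall>i<m. \<forall>x\<in>V. ((\<lambda>t. F (x(i := t)) j) has_real_derivative v j i x) (at (x i))) \<and>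
        (\<forall>i<m. Ck_on k m V (v j i))" by (intro choice) blast
    then obtain v where v:
      "\<And>i j x. j < n \<Longrightarrow> i < m \<Longrightarrow> x \<in> V \<Longrightarrow>
         ((\<lambda>t. F (x(i := t)) j) has_real_derivative v j i x) (at (x i))"
      "\<And>i j. j < n \<Longrightarrow> i < m \<Longrightarrow> Ck_on k m V (v j i)"
      by blast
    show ?case
    proof (rule Ck_on_SucI[OF V, where g = "\<lambda>i x. \<Sum>j<n. d j (F x) * v j i x"])
      show "continuous_on V (\<lambda>x. r (F x))"
        by (rule cont[OF Ck_on_imp_continuous_on[OF U Suc.prems(1)]
              Ck_on_imp_continuous_on[OF V Suc.prems(2)]])
      show "Ck_on k m V (\<lambda>x. \<Sum>j<n. d j (F x) * v j i x)" if i: "i < m" for i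
      proof (rule Ck_on_sum[OF V], rule Ck_on_mult[OF V])
        fix j assume "j \<in> {..<n}"
        then have j: "j < n" by simp
        show "Ck_on k m V (\<lambda>x. d j (F x))"
          by (rule Suc.IH[OF d(2)[OF j] Ck_on_SucD[OF V Suc.prems(2)]])
        show "Ck_on k m V (v j i)" by (rule v(2)[OF j i])
      qed
      fix i x assume i: "i < m" and x: "x \<in> V"
      have "eventually (\<lambda>t. F (x(i := t)) \<in> U) (nhds (x i))"
        using openin_Euclidean_space_update[OF V x i] by eventually_elim (use F in auto)
      from chain_rule_partial_derivatives[OF U this v(1)[OF _ i x] d(1) Ck_on_imp_continuous_on[OF U d(2)]]
      show "((\<lambda>t. r (F (x(i := t)))) has_real_derivative (\<Sum>j<n. d j (F x) * v j i x)) (at (x i))"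
        by simp
    qed
  }
qed

text \<open>These functions all vanish to infinite order at 0, and as a family they are closed under
  differentiation; \<open>flat_fun 1\<close> is the usual cutoff \<open>exp (- 1 / t)\<close>.\<close>

definition flat_fun :: "real poly \<Rightarrow> real \<Rightarrow> real" where
  "flat_fun p t = (if t > 0 then poly p (1 / t) * exp (- 1 / t) else 0)"

lemma poly_times_exp_minus_tendsto_0: "((\<lambda>x. poly p x * exp (- x)) \<longlongrightarrow> (0::real)) at_top"
proof -
  have "((\<lambda>x. \<Sum>i\<le>degree p. coeff p i * (x ^ i / exp x)) \<longlongrightarrow> (\<Sum>i\<le>degree p. coeff p i * 0)) at_top"
    by (intro tendsto_sum tendsto_mult tendsto_const tendsto_power_div_exp_0)
  then show ?thesis
    by (simp add: poly_altdef sum_distrib_right exp_minus field_simps sum_divide_distrib)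
qed

text \<open>Put s = 1/t. Then ds/dt = -s^2, and p(s) exp(-s) has s-derivative (p' - p)(s) exp(-s).
  The product of the two is the polynomial X^2 (p - p') at s times exp(-s).\<close>

lemma flat_fun_has_derivative:
  "(flat_fun p has_real_derivative flat_fun (monom 1 2 * (p - pderiv p)) t) (at t)"
proof -
  consider "t > 0" | "t < 0" | "t = 0" by linarith
  then show ?thesis
  proof cases
    case 1
    have "((\<lambda>t. poly p (1 / t) * exp (- 1 / t)) has_real_derivative
        poly (monom 1 2 * (p - pderiv p)) (1 / t) * exp (- 1 / t)) (at t)"
      using 1 by (auto intro!: derivative_eq_intros DERIV_chain2[OF poly_DERIV]
          simp: poly_monom field_simps power2_eq_square)
    moreover have "eventually (\<lambda>s. s \<in> {0<..}) (nhds t)"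
      using 1 by (intro eventually_nhds_in_open) auto
    then have "eventually (\<lambda>s. flat_fun p s = poly p (1 / s) * exp (- 1 / s)) (nhds t)"
      by eventually_elim (simp add: flat_fun_def)
    ultimately show ?thesis
      using 1 DERIV_cong_ev[OF refl _ refl] by (fastforce simp: flat_fun_def)
  next
    case 2
    have "eventually (\<lambda>s. s \<in> {..<0}) (nhds t)"
      using 2 by (intro eventually_nhds_in_open) auto
    then have "eventually (\<lambda>s. flat_fun p s = 0) (nhds t)"
      by eventually_elim (simp add: flat_fun_def)
    from DERIV_cong_ev[OF refl this refl, of 0]
    have "(flat_fun p has_real_derivative 0) (at t)" by simp
    moreover have "flat_fun q t = 0" for q using 2 by (simp add: flat_fun_def)
    ultimately show ?thesis by simp
  next
    case 3
    \<comment> \<open>\<open>pCons 0 p\<close> is X * p: the extra factor 1/h turns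
      \<open>flat_fun p h\<close> into the difference quotient at 0.\<close>
    have "((\<lambda>h. poly (pCons 0 p) (inverse h) * exp (- inverse h)) \<longlongrightarrow> 0) (at_right (0::real))"
      by (rule filterlim_compose[OF poly_times_exp_minus_tendsto_0 filterlim_inverse_at_top_right])
    then have "((\<lambda>h. flat_fun p h / h) \<longlongrightarrow> 0) (at_right 0)"
      by (rule Lim_transform_eventually)
        (auto simp: eventually_at_right_field flat_fun_def field_simps intro!: exI[of _ 1])
    moreover have "((\<lambda>h. flat_fun p h / h) \<longlongrightarrow> 0) (at_left 0)"
      by (rule tendsto_eventually)
        (auto simp: eventually_at_left_field flat_fun_def intro!: exI[of _ "-1"])
    ultimately have "((\<lambda>h. flat_fun p h / h) \<longlongrightarrow> 0) (at 0)"
      by (simp add: filterlim_split_at)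
    then show ?thesis
      using 3 by (simp add: DERIV_def flat_fun_def)
  qed
qed

lemma flat_fun_1_pos_iff: "flat_fun 1 t > 0 \<longleftrightarrow> t > 0"
  by (simp add: flat_fun_def)

lemma flat_fun_1_nonneg: "flat_fun 1 t \<ge> 0"
  by (simp add: flat_fun_def)

lemma Ck_on_flat_fun:
  assumes U: "openin (Euclidean_space n) U"
  shows "Ck_on k n U f \<Longrightarrow> Ck_on k n U (\<lambda>x. flat_fun p (f x))"
proof (induction k arbitrary: p)
  have cont: "continuous_on U (\<lambda>x. flat_fun p (f x))" if "continuous_on U f" for p
  proof -
    have "continuous_on UNIV (flat_fun p)"
      using DERIV_isCont[OF flat_fun_has_derivative] by (simp add: continuous_at_imp_continuous_on)
    then show ?thesis using continuous_on_compose2[OF _ that] by blast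
  qed
  {
    case 0
    then show ?case using cont by (simp add: Ck_on_0[OF U])
  next
    case (Suc k)
    from Ck_on_SucE[OF Suc.prems(1)] obtain f' where f':
      "\<And>i x. i < n \<Longrightarrow> x \<in> U \<Longrightarrow> ((\<lambda>t. f (x(i := t))) has_real_derivative f' i x) (at (x i))"
      "\<And>i. i < n \<Longrightarrow> Ck_on k n U (f' i)" by metis
    let ?q = "monom 1 2 * (p - pderiv p)"
    show ?case
    proof (rule Ck_on_SucI[OF U, where g = "\<lambda>i x. flat_fun ?q (f x) * f' i x"])
      show "continuous_on U (\<lambda>x. flat_fun p (f x))"
        by (rule cont[OF Ck_on_imp_continuous_on[OF U Suc.prems]])
      show "((\<lambda>t. flat_fun p (f (x(i := t)))) has_real_derivative flat_fun ?q (f x) * f' i x) (at (x i))"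
        if "i < n" "x \<in> U" for i x
        using DERIV_chain2[OF flat_fun_has_derivative f'(1)[OF that]] by simp
      show "Ck_on k n U (\<lambda>x. flat_fun ?q (f x) * f' i x)" if "i < n" for i
        by (rule Ck_on_mult[OF U Suc.IH[OF Ck_on_SucD[OF U Suc.prems]] f'(2)[OF that]])
    qed
  }
qed

section \<open>Smooth functions and smooth maps\<close>

lemma smooth_fun_continuous_on:
  "openin (Euclidean_space n) U \<Longrightarrow> smooth_fun n U f \<Longrightarrow> continuous_on U f"
  using Ck_on_imp_continuous_on[of n U 0 f] by (auto simp: smooth_fun_def)

lemma smooth_fun_cong:
  "openin (Euclidean_space n) U \<Longrightarrow> smooth_fun n U f \<Longrightarrow> (\<And>x. x \<in> U \<Longrightarrow> f' x = f x) \<Longrightarrow>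
    smooth_fun n U f'"
  unfolding smooth_fun_def using Ck_on_cong by blast

lemma smooth_fun_subset:
  "openin (Euclidean_space n) V \<Longrightarrow> V \<subseteq> U \<Longrightarrow> openin (Euclidean_space n) U \<Longrightarrow>
    smooth_fun n U f \<Longrightarrow> smooth_fun n V f"
  unfolding smooth_fun_def using Ck_on_subset by blast

lemma smooth_fun_Union:
  "(\<And>U. U \<in> \<U> \<Longrightarrow> openin (Euclidean_space n) U) \<Longrightarrow>
    (\<And>U. U \<in> \<U> \<Longrightarrow> smooth_fun n U f) \<Longrightarrow> smooth_fun n (\<Union>\<U>) f"
  unfolding smooth_fun_def using Ck_on_Union by metis

lemma smooth_fun_const: "openin (Euclidean_space n) U \<Longrightarrow> smooth_fun n U (\<lambda>_. c)"
  unfolding smooth_fun_def using Ck_on_const by blast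

lemma smooth_fun_coordinate: "openin (Euclidean_space n) U \<Longrightarrow> smooth_fun n U (\<lambda>x. x j)"
  unfolding smooth_fun_def using Ck_on_coordinate by blast

lemma smooth_fun_add:
  "openin (Euclidean_space n) U \<Longrightarrow> smooth_fun n U f \<Longrightarrow> smooth_fun n U g \<Longrightarrow>
    smooth_fun n U (\<lambda>x. f x + g x)"
  unfolding smooth_fun_def using Ck_on_add by blast

lemma smooth_fun_mult:
  "openin (Euclidean_space n) U \<Longrightarrow> smooth_fun n U f \<Longrightarrow> smooth_fun n U g \<Longrightarrow>
    smooth_fun n U (\<lambda>x. f x * g x)"
  unfolding smooth_fun_def using Ck_on_mult by blast

lemma smooth_fun_diff:
  assumes U: "openin (Euclidean_space n) U" and "smooth_fun n U f" "smooth_fun n U g"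
  shows "smooth_fun n U (\<lambda>x. f x - g x)"
  using smooth_fun_add[OF U assms(2) smooth_fun_mult[OF U smooth_fun_const[OF U, of "-1"] assms(3)]]
  by simp

lemma smooth_fun_sum:
  assumes U: "openin (Euclidean_space n) U"
  shows "(\<And>i. i \<in> I \<Longrightarrow> smooth_fun n U (f i)) \<Longrightarrow> smooth_fun n U (\<lambda>x. \<Sum>i\<in>I. f i x)"
  by (induction I rule: infinite_finite_induct)
    (simp_all add: smooth_fun_const[OF U] smooth_fun_add[OF U])

lemma smooth_fun_prod:
  assumes U: "openin (Euclidean_space n) U"
  shows "(\<And>i. i \<in> I \<Longrightarrow> smooth_fun n U (f i)) \<Longrightarrow> smooth_fun n U (\<lambda>x. \<Prod>i\<in>I. f i x)"
  by (induction I rule: infinite_finite_induct)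
    (simp_all add: smooth_fun_const[OF U] smooth_fun_mult[OF U])

lemma smooth_fun_inverse:
  "openin (Euclidean_space n) U \<Longrightarrow> smooth_fun n U f \<Longrightarrow> (\<And>x. x \<in> U \<Longrightarrow> f x \<noteq> 0) \<Longrightarrow>
    smooth_fun n U (\<lambda>x. inverse (f x))"
  unfolding smooth_fun_def using Ck_on_inverse by blast

lemma smooth_fun_flat_fun:
  "openin (Euclidean_space n) U \<Longrightarrow> smooth_fun n U f \<Longrightarrow> smooth_fun n U (\<lambda>x. flat_fun p (f x))"
  unfolding smooth_fun_def using Ck_on_flat_fun by blast

lemma smooth_fun_compose:
  assumes "openin (Euclidean_space n) U" "openin (Euclidean_space m) V"
    and "smooth_fun n U r" "smooth_map m V n U f"
  shows "smooth_fun m V (\<lambda>x. r (f x))"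
  using assms Ck_on_compose[OF assms(1,2)] unfolding smooth_fun_def smooth_map_def by blast

lemma smooth_map_compose:
  assumes "openin (Euclidean_space n) U" "openin (Euclidean_space m) V"
    and "smooth_map n U l T g" "smooth_map m V n U f"
  shows "smooth_map m V l T (g \<circ> f)"
  using assms smooth_fun_compose[OF assms(1,2) _ assms(4)] by (auto simp: smooth_map_def Pi_iff)

lemma smooth_map_subset:
  assumes "smooth_map m V n U f" "openin (Euclidean_space m) V" "openin (Euclidean_space m) V'" "V' \<subseteq> V"
    and "\<And>x. x \<in> V' \<Longrightarrow> f x \<in> U'"
  shows "smooth_map m V' n U' f"
  using assms smooth_fun_subset[OF assms(3,4,2)] by (auto simp: smooth_map_def)

lemma smooth_map_cong:
  assumes "smooth_map m V n U f" "openin (Euclidean_space m) V" "\<And>x. x \<in> V \<Longrightarrow> f' x = f x"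
  shows "smooth_map m V n U f'"
  using assms smooth_fun_cong[OF assms(2)] by (auto simp: smooth_map_def Pi_iff)

lemma smooth_map_Union:
  assumes "\<And>V. V \<in> \<V> \<Longrightarrow> smooth_map m V n U f" "\<And>V. V \<in> \<V> \<Longrightarrow> openin (Euclidean_space m) V"
  shows "smooth_map m (\<Union>\<V>) n U f"
  using assms by (auto simp: smooth_map_def intro!: smooth_fun_Union)

lemma smooth_map_id:
  "openin (Euclidean_space n) U \<Longrightarrow> V \<subseteq> U \<Longrightarrow> openin (Euclidean_space n) V \<Longrightarrow> smooth_map n V n U (\<lambda>x. x)"
  by (auto simp: smooth_map_def smooth_fun_coordinate)

lemma smooth_map_continuous_on:
  assumes "openin (Euclidean_space n) U" "openin (Euclidean_space m) V" "smooth_map m V n U f"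
  shows "continuous_on V f"
proof (rule continuous_on_coordinatewise_then_product)
  fix j
  show "continuous_on V (\<lambda>x. f x j)"
  proof (cases "j < n")
    case True
    then show ?thesis
      using assms by (auto simp: smooth_map_def intro: smooth_fun_continuous_on)
  next
    case False
    have "f x \<in> U" if "x \<in> V" for x using assms(3) that by (auto simp: smooth_map_def)
    then have "continuous_on V (\<lambda>x. f x j) \<longleftrightarrow> continuous_on V (\<lambda>_. 0 :: real)"
      using openin_Euclidean_space_subset[OF assms(1)] False by (intro continuous_on_cong) auto
    then show ?thesis by simp
  qed
qed

section \<open>Diffeological spaces\<close>

text \<open>Restriction is precomposition with the inclusion, which is smooth.\<close>

lemma (in diffeological_space) plot_subset:
  assumes "P n U p" "openin (Euclidean_space n) V" "V \<subseteq> U"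
  shows "P n V p"
  using plot_comp[OF assms(1,2) smooth_map_id[OF plot_open[OF assms(1)] assms(3,2)]]
  by (simp add: o_def)

text \<open>The gluing axiom in pointwise form: the domain is the union of all its subsets on which
  the map is a plot.\<close>

lemma (in diffeological_space) plot_local:
  assumes "\<And>u. u \<in> U \<Longrightarrow> \<exists>V. u \<in> V \<and> V \<subseteq> U \<and> P n V p"
  shows "P n U p"
proof -
  have "P n (\<Union>{V. V \<subseteq> U \<and> P n V p}) p"
    by (rule plot_cover) simp
  moreover have "\<Union>{V. V \<subseteq> U \<and> P n V p} = U"
    using assms by blast
  ultimately show ?thesis by simp
qed

text \<open>The empty family covers the empty set. This serves the case of an empty
  manifold.\<close>

lemma (in diffeological_space) plot_empty: "P n {} p"
  using plot_cover[of "{}"] by simp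

lemma diffeological_space_real_plots: "diffeological_space UNIV real_plots"
proof
  show "real_plots n U q" if "real_plots n U p" "\<And>u. u \<in> U \<Longrightarrow> q u = p u" for n U p q
    using that smooth_fun_cong by (auto simp: real_plots_def)
  show "real_plots m V (p \<circ> f)"
    if "real_plots n U p" "openin (Euclidean_space m) V" "smooth_map m V n U f" for n U p m V f
    using that smooth_fun_compose[of n U m V p f] by (auto simp: real_plots_def o_def)
  show "real_plots n (\<Union>\<U>) p" if "\<And>U. U \<in> \<U> \<Longrightarrow> real_plots n U p" for \<U> n p
    using that by (auto simp: real_plots_def intro: smooth_fun_Union)
qed (auto simp: real_plots_def smooth_fun_const)

lemma smooth_fun_local:
  assumes "openin (Euclidean_space m) U"
    and "\<And>u. u \<in> U \<Longrightarrow> \<exists>V. u \<in> V \<and> V \<subseteq> U \<and> openin (Euclidean_space m) V \<and> smooth_fun m V f"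
  shows "smooth_fun m U f"
  using diffeological_space.plot_local[OF diffeological_space_real_plots, of U m f] assms(2)
  by (auto simp: real_plots_def)

lemma diffeological_space_generated_plots:
  assumes G: "\<And>n U p. G n U p \<Longrightarrow> openin (Euclidean_space n) U \<and> p \<in> U \<rightarrow> X"
  shows "diffeological_space X (generated_plots X G)"
proof -
  \<comment> \<open>All maps from open sets into \<open>X\<close> form a diffeology containing
    \<open>G\<close>. As a competitor in the intersection it forces open domains and values in
    \<open>X\<close>.\<close>
  define I where "I n U p \<longleftrightarrow> openin (Euclidean_space n) U \<and> p \<in> U \<rightarrow> X" for n U and p :: "(nat \<Rightarrow> real) \<Rightarrow> 'a"
  have "diffeological_space X I"
    by unfold_locales (auto simp: I_def smooth_map_def Pi_iff)
  then have I: "I n U p" if "generated_plots X G n U p" for n U p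
    using that[unfolded generated_plots_def, rule_format, of I] G \<open>diffeological_space X I\<close>
    unfolding I_def by blast
  show ?thesis
  proof
    fix n U p assume p: "generated_plots X G n U p"
    show "openin (Euclidean_space n) U" "p \<in> U \<rightarrow> X"
      using I[OF p] by (auto simp: I_def)
    have pP: "P n U p" if "diffeological_space X P \<and> (\<forall>m V q. G m V q \<longrightarrow> P m V q)" for P
      using p that unfolding generated_plots_def by blast
    show "generated_plots X G n U q" if q: "\<And>u. u \<in> U \<Longrightarrow> q u = p u" for q
      unfolding generated_plots_def
      by (intro allI impI) (rule diffeological_space.plot_cong[OF conjunct1 pP q])
    show "generated_plots X G m V (p \<circ> f)"
      if V: "openin (Euclidean_space m) V" and f: "smooth_map m V n U f" for m V f
      unfolding generated_plots_def
      by (intro allI impI) (rule diffeological_space.plot_comp[OF conjunct1 pP V f])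
  next
    fix n U x assume U: "openin (Euclidean_space n) U" and x: "x \<in> X"
    show "generated_plots X G n U (\<lambda>_. x)"
      unfolding generated_plots_def
      by (intro allI impI) (rule diffeological_space.plot_const[OF conjunct1 U x])
  next
    fix \<U> n p assume \<U>: "\<And>U. U \<in> \<U> \<Longrightarrow> generated_plots X G n U p"
    show "generated_plots X G n (\<Union>\<U>) p"
      unfolding generated_plots_def
      by (intro allI impI, rule diffeological_space.plot_cover[OF conjunct1])
        (use \<U> in \<open>auto simp: generated_plots_def\<close>)
  qed
qed

lemma generated_plots_generator: "G n U p \<Longrightarrow> generated_plots X G n U p"
  by (simp add: generated_plots_def)

lemma generated_plots_induct:
  assumes "generated_plots X G n U p" "diffeological_space X P" "\<And>n U p. G n U p \<Longrightarrow> P n U p"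
  shows "P n U p"
  using assms by (auto simp: generated_plots_def)

context
  fixes V :: "'v::real_vector set" and P :: "'v plots"
  assumes V: "diffeological_vector_space V P"
begin

lemma dvs_diffeological_space: "diffeological_space V P"
  using V by (simp add: diffeological_vector_space_def)

lemma dvs_subspace: "subspace V"
  using V by (simp add: diffeological_vector_space_def)

lemma dvs_plot_add:
  assumes "P n U p" "P n U q"
  shows "P n U (\<lambda>u. p u + q u)"
proof -
  have "prod_plots P P n U (\<lambda>u. (p u, q u))"
    using assms by (simp add: prod_plots_def o_def)
  then have "P n U ((\<lambda>(x, y). x + y) \<circ> (\<lambda>u. (p u, q u)))"
    using V unfolding diffeological_vector_space_def smooth_between_def by blast
  then show ?thesis by (simp add: o_def)
qed

lemma dvs_plot_scaleR:
  assumes "openin (Euclidean_space n) U" "smooth_fun n U r" "P n U p"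
  shows "P n U (\<lambda>u. r u *\<^sub>R p u)"
proof -
  have "prod_plots real_plots P n U (\<lambda>u. (r u, p u))"
    using assms by (simp add: prod_plots_def real_plots_def o_def)
  then have "P n U ((\<lambda>(r, x). r *\<^sub>R x) \<circ> (\<lambda>u. (r u, p u)))"
    using V unfolding diffeological_vector_space_def smooth_between_def by blast
  then show ?thesis by (simp add: o_def)
qed

lemma dvs_plot_sum:
  assumes "openin (Euclidean_space n) U" "\<And>i. i \<in> I \<Longrightarrow> P n U (p i)"
  shows "P n U (\<lambda>u. \<Sum>i\<in>I. p i u)"
  using assms(2)
proof (induction I rule: infinite_finite_induct)
  case (insert i I)
  then show ?case by (simp add: dvs_plot_add)
qed (simp_all add: diffeological_space.plot_const[OF dvs_diffeological_space assms(1)]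
      subspace_0[OF dvs_subspace])

end

section \<open>The standard diffeology of a manifold\<close>

lemma openin_continuous_preimage_Euclidean_space:
  assumes "openin (Euclidean_space m) U" "continuous_map (subtopology (Euclidean_space m) U) M p" "openin M W"
  shows "openin (Euclidean_space m) {u \<in> U. p u \<in> W}"
proof -
  have "openin (subtopology (Euclidean_space m) U) {u \<in> topspace (subtopology (Euclidean_space m) U). p u \<in> W}"
    using assms(2,3) by (rule openin_continuous_map_preimage)
  moreover have "topspace (subtopology (Euclidean_space m) U) = U"
    using openin_subset[OF assms(1)] by auto
  ultimately have "openin (subtopology (Euclidean_space m) U) {u \<in> U. p u \<in> W}"
    by (simp only:)
  then show ?thesis using openin_trans_full[OF _ assms(1)] by blast
qed

text \<open>The continuity demanded in \<open>manifold_plots\<close> makes every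
  \<open>{u \<in> U. p u \<in> W}\<close> open. On these sets the axioms reduce, chart by chart, to
  composing and gluing smooth maps between Euclidean open sets.\<close>

lemma diffeological_space_manifold_plots:
  assumes "smooth_manifold n M A"
  shows "diffeological_space (topspace M) (manifold_plots n M A)"
proof -
  interpret smooth_manifold n M A by fact
  note opn = openin_continuous_preimage_Euclidean_space
  show ?thesis
  proof
    fix m U p assume p: "manifold_plots n M A m U p"
    then have U: "openin (Euclidean_space m) U" by (simp add: manifold_plots_def)
    have p_cont: "continuous_map (subtopology (Euclidean_space m) U) M p"
      using p by (simp add: manifold_plots_def)
    have top: "topspace (subtopology (Euclidean_space m) U) = U"
      using openin_subset[OF U] by auto
    show "openin (Euclidean_space m) U" by fact
    show "p \<in> U \<rightarrow> topspace M"
      using continuous_map_funspace[OF p_cont] top by simp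
    show "manifold_plots n M A m U q" if q: "\<And>u. u \<in> U \<Longrightarrow> q u = p u" for q
    proof -
      have "continuous_map (subtopology (Euclidean_space m) U) M q"
        using continuous_map_eq[OF p_cont] q top by simp
      moreover have "smooth_map m {u \<in> U. q u \<in> W} n (\<phi> ` W) (\<phi> \<circ> q)" if A: "(W, \<phi>) \<in> A" for W \<phi>
      proof -
        have *: "{u \<in> U. q u \<in> W} = {u \<in> U. p u \<in> W}" using q by auto
        have "smooth_map m {u \<in> U. p u \<in> W} n (\<phi> ` W) (\<phi> \<circ> p)"
          using p A by (auto simp: manifold_plots_def)
        then show ?thesis unfolding *
          by (rule smooth_map_cong[OF _ opn[OF U p_cont chart_domain[OF A]]]) (simp add: q)
      qed
      ultimately show ?thesis using U by (auto simp: manifold_plots_def)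
    qed
    show "manifold_plots n M A l V (p \<circ> f)"
      if V: "openin (Euclidean_space l) V" and f: "smooth_map l V m U f" for l V f
    proof -
      have fV: "f ` V \<subseteq> U" using f by (auto simp: smooth_map_def)
      have "continuous_on V f"
        by (rule smooth_map_continuous_on[OF U V f])
      then have "continuous_map (subtopology (Euclidean_space l) V) (subtopology (Euclidean_space m) U) f"
        using fV by (simp add: subtopology_Euclidean_space_openin[OF U] subtopology_Euclidean_space_openin[OF V]
            image_subset_iff_funcset)
      then have c: "continuous_map (subtopology (Euclidean_space l) V) M (p \<circ> f)"
        by (rule continuous_map_compose[OF _ p_cont])
      moreover have "smooth_map l {u \<in> V. (p \<circ> f) u \<in> W} n (\<phi> ` W) (\<phi> \<circ> (p \<circ> f))"
        if A: "(W, \<phi>) \<in> A" for W \<phi>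
      proof -
        let ?V = "{u \<in> V. (p \<circ> f) u \<in> W}"
        have V': "openin (Euclidean_space l) ?V" by (rule opn[OF V c chart_domain[OF A]])
        have "smooth_map l ?V m {u \<in> U. p u \<in> W} f"
          by (rule smooth_map_subset[OF f V V']) (use fV in auto)
        moreover have "smooth_map m {u \<in> U. p u \<in> W} n (\<phi> ` W) (\<phi> \<circ> p)"
          using p A by (auto simp: manifold_plots_def)
        ultimately have "smooth_map l ?V n (\<phi> ` W) ((\<phi> \<circ> p) \<circ> f)"
          using smooth_map_compose[OF opn[OF U p_cont chart_domain[OF A]] V'] by blast
        then show ?thesis by (simp add: o_assoc)
      qed
      ultimately show ?thesis using V by (auto simp: manifold_plots_def)
    qed
  next
    fix m U x assume U: "openin (Euclidean_space m) U" and x: "x \<in> topspace M"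
    have "smooth_map m {u \<in> U. x \<in> W} n (\<phi> ` W) (\<phi> \<circ> (\<lambda>_. x))" if "(W, \<phi>) \<in> A" for W \<phi>
    proof -
      have "openin (Euclidean_space m) {u \<in> U. x \<in> W}" using U by (cases "x \<in> W") auto
      then show ?thesis by (auto simp: smooth_map_def o_def smooth_fun_const)
    qed
    then show "manifold_plots n M A m U (\<lambda>_. x)"
      using U x by (auto simp: manifold_plots_def)
  next
    fix \<U> m p assume \<U>: "\<And>U. U \<in> \<U> \<Longrightarrow> manifold_plots n M A m U p"
    have \<U>o: "\<And>U. U \<in> \<U> \<Longrightarrow> openin (Euclidean_space m) U"
      using \<U> by (simp add: manifold_plots_def)
    then have UU: "openin (Euclidean_space m) (\<Union>\<U>)" by (rule openin_Union)
    have c: "continuous_map (subtopology (Euclidean_space m) (\<Union>\<U>)) M p"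
    proof (rule pasting_lemma[where T = "\<lambda>U. U" and I = \<U> and f = "\<lambda>_. p"])
      fix U assume U: "U \<in> \<U>"
      then show "openin (subtopology (Euclidean_space m) (\<Union>\<U>)) U"
        using \<U>o[OF U] openin_open_subtopology[OF UU] by auto
      have "(\<Union>\<U>) \<inter> U = U" using U by auto
      then show "continuous_map (subtopology (subtopology (Euclidean_space m) (\<Union>\<U>)) U) M p"
        using \<U>[OF U] by (simp add: subtopology_subtopology manifold_plots_def)
    qed auto
    moreover have "smooth_map m {u \<in> \<Union>\<U>. p u \<in> W} n (\<phi> ` W) (\<phi> \<circ> p)" if A: "(W, \<phi>) \<in> A" for W \<phi>
    proof -
      have *: "{u \<in> \<Union>\<U>. p u \<in> W} = \<Union>((\<lambda>U. {u \<in> U. p u \<in> W}) ` \<U>)" by auto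
      show ?thesis unfolding *
      proof (rule smooth_map_Union)
        fix V assume "V \<in> (\<lambda>U. {u \<in> U. p u \<in> W}) ` \<U>"
        then obtain U where U: "U \<in> \<U>" and V: "V = {u \<in> U. p u \<in> W}" by auto
        show "smooth_map m V n (\<phi> ` W) (\<phi> \<circ> p)"
          using \<U>[OF U] A V by (auto simp: manifold_plots_def)
        show "openin (Euclidean_space m) V"
          unfolding V using \<U>[OF U] \<U>o[OF U] by (intro opn[OF _ _ chart_domain[OF A]]) (auto simp: manifold_plots_def)
      qed
    qed
    ultimately show "manifold_plots n M A m (\<Union>\<U>) p"
      using UU by (auto simp: manifold_plots_def)
  qed
qed

section \<open>Free diffeological vector spaces\<close>

lemma lookup_scaleR: "Poly_Mapping.lookup (r *\<^sub>R v) x = r *\<^sub>R Poly_Mapping.lookup v x"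
  for v :: "'a \<Rightarrow>\<^sub>0 'b::real_vector"
proof -
  have "finite {x. r *\<^sub>R Poly_Mapping.lookup v x \<noteq> 0}"
    by (rule finite_subset[OF _ finite_keys[of v]]) (auto simp: in_keys_iff)
  then show ?thesis by (simp add: scaleR_poly_mapping_def lookup_Abs_poly_mapping)
qed

lemma subspace_free_vs: "subspace (free_vs X)"
proof (rule subspaceI)
  show "v + w \<in> free_vs X" if "v \<in> free_vs X" "w \<in> free_vs X" for v w
    using that keys_add[of v w] by (auto simp: free_vs_def)
  show "r *\<^sub>R v \<in> free_vs X" if "v \<in> free_vs X" for r v
    using that by (auto simp: free_vs_def in_keys_iff lookup_scaleR)
qed (simp add: free_vs_def)

lemma free_basis_in_free_vs: "x \<in> X \<Longrightarrow> free_basis x \<in> free_vs X"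
  by (simp add: free_vs_def)

section \<open>Formal sums with smooth coefficients as the plots of the free space\<close>

lemma poly_mapping_eq_sum_free_basis:
  assumes "finite S" "Poly_Mapping.keys v \<subseteq> S"
  shows "v = (\<Sum>x\<in>S. Poly_Mapping.lookup v x *\<^sub>R free_basis x)"
proof (rule poly_mapping_eqI)
  fix y
  have "(\<Sum>x\<in>S. Poly_Mapping.lookup v x *\<^sub>R Poly_Mapping.lookup (free_basis x) y) =
      (\<Sum>x\<in>S. if x = y then Poly_Mapping.lookup v y else 0)"
    by (rule sum.cong) (auto simp: lookup_single when_def)
  then show "Poly_Mapping.lookup v y =
      Poly_Mapping.lookup (\<Sum>x\<in>S. Poly_Mapping.lookup v x *\<^sub>R free_basis x) y"
    using assms by (auto simp: lookup_sum lookup_scaleR in_keys_iff)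
qed

text \<open>A list of terms rather than a sum over a set of points: as \<open>u\<close> varies, the
  points of different terms may collide, and their coefficients then add up, while the list keeps
  the terms apart.\<close>

definition combination :: "(('u \<Rightarrow> real) \<times> ('u \<Rightarrow> 'a)) list \<Rightarrow> 'u \<Rightarrow> ('a \<Rightarrow>\<^sub>0 real)" where
  "combination xs u = (\<Sum>(r, x)\<leftarrow>xs. r u *\<^sub>R free_basis (x u))"

definition smooth_terms :: "'a plots \<Rightarrow> nat \<Rightarrow> (nat \<Rightarrow> real) set \<Rightarrow>
    (((nat \<Rightarrow> real) \<Rightarrow> real) \<times> ((nat \<Rightarrow> real) \<Rightarrow> 'a)) list \<Rightarrow> bool" where
  "smooth_terms P n U xs \<longleftrightarrow> (\<forall>(r, x) \<in> set xs. smooth_fun n U r \<and> P n U x)"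

text \<open>These turn out to be exactly the plots of the free space, see \<open>free_plots_eq\<close>.\<close>

definition combination_plots :: "'a plots \<Rightarrow> ('a \<Rightarrow>\<^sub>0 real) plots" where
  "combination_plots P n U p \<longleftrightarrow> openin (Euclidean_space n) U \<and>
     (\<forall>u\<in>U. \<exists>V xs. u \<in> V \<and> V \<subseteq> U \<and> openin (Euclidean_space n) V \<and>
        smooth_terms P n V xs \<and> (\<forall>v\<in>V. p v = combination xs v))"

lemma combination_append: "combination (xs @ ys) u = combination xs u + combination ys u"
  by (simp add: combination_def)

lemma combination_Cons:
  "combination (rx # xs) u = fst rx u *\<^sub>R free_basis (snd rx u) + combination xs u"
  by (simp add: combination_def case_prod_unfold)

lemma combination_Nil: "combination [] u = 0"
  by (simp add: combination_def)

lemma combination_scale: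
  "combination (map (\<lambda>(r, x). (\<lambda>u. s u * r u, x)) xs) u = s u *\<^sub>R combination xs u"
  by (induction xs) (auto simp: combination_Cons combination_Nil scaleR_add_right)

lemma combination_comp:
  "combination (map (\<lambda>(r, x). (r \<circ> f, x \<circ> f)) xs) u = combination xs (f u)"
  by (induction xs) (auto simp: combination_Cons combination_Nil)

lemma combination_plotsI:
  assumes "openin (Euclidean_space n) U" "smooth_terms P n U xs" "\<And>u. u \<in> U \<Longrightarrow> p u = combination xs u"
  shows "combination_plots P n U p"
  unfolding combination_plots_def using assms by blast

context diffeological_space
begin

lemma smooth_terms_subset:
  assumes "smooth_terms P n U xs" "openin (Euclidean_space n) U" "openin (Euclidean_space n) V" "V \<subseteq> U"
  shows "smooth_terms P n V xs"
  using assms plot_subset[OF _ assms(3,4)] smooth_fun_subset[OF assms(3,4,2)]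
  by (fastforce simp: smooth_terms_def)

text \<open>A generated diffeology lies in every diffeology that contains the generators. Together
  with \<open>free_generators_combination_plots\<close> this bounds the plots of the free space from
  above.\<close>

lemma diffeological_space_combination_plots:
  "diffeological_space (free_vs X) (combination_plots P)"
proof
  fix n U p assume p: "combination_plots P n U p"
  then show U: "openin (Euclidean_space n) U" by (simp add: combination_plots_def)
  show "p \<in> U \<rightarrow> free_vs X"
  proof
    fix u assume "u \<in> U"
    then obtain V xs where V: "u \<in> V" "smooth_terms P n V xs" "\<And>v. v \<in> V \<Longrightarrow> p v = combination xs v"
      using p unfolding combination_plots_def by blast
    have "combination xs u \<in> free_vs X"
      using V(2)
    proof (induction xs)
      case Nil
      then show ?case by (simp add: combination_Nil subspace_0[OF subspace_free_vs])
    next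
      case (Cons rx xs)
      have "snd rx u \<in> X" using Cons.prems V(1) plot_into[of n V "snd rx"]
        by (auto simp: smooth_terms_def case_prod_unfold)
      moreover have "combination xs u \<in> free_vs X" using Cons by (simp add: smooth_terms_def)
      ultimately show ?case
        unfolding combination_Cons
        by (intro subspace_add[OF subspace_free_vs] subspace_scale[OF subspace_free_vs] free_basis_in_free_vs)
    qed
    then show "p u \<in> free_vs X" using V by simp
  qed
  show "combination_plots P n U q" if q: "\<And>u. u \<in> U \<Longrightarrow> q u = p u" for q
    unfolding combination_plots_def
  proof (intro conjI ballI)
    fix u assume "u \<in> U"
    then obtain V xs where V: "u \<in> V" "V \<subseteq> U" "openin (Euclidean_space n) V" "smooth_terms P n V xs"
        "\<And>v. v \<in> V \<Longrightarrow> p v = combination xs v"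
      using p unfolding combination_plots_def by blast
    then have "\<forall>v\<in>V. q v = combination xs v" using q by auto
    with V show "\<exists>V xs. u \<in> V \<and> V \<subseteq> U \<and> openin (Euclidean_space n) V \<and>
        smooth_terms P n V xs \<and> (\<forall>v\<in>V. q v = combination xs v)" by blast
  qed (rule U)
  show "combination_plots P m W (p \<circ> f)"
    if W: "openin (Euclidean_space m) W" and f: "smooth_map m W n U f" for m W f
    unfolding combination_plots_def
  proof (intro conjI ballI)
    fix w assume w: "w \<in> W"
    then have "f w \<in> U" using f by (auto simp: smooth_map_def)
    then obtain V xs where V: "f w \<in> V" "V \<subseteq> U" "openin (Euclidean_space n) V" "smooth_terms P n V xs"
        "\<And>v. v \<in> V \<Longrightarrow> p v = combination xs v"
      using p unfolding combination_plots_def by blast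
    let ?W = "{w \<in> W. f w \<in> V}"
    have W': "openin (Euclidean_space m) ?W"
    proof -
      obtain T where T: "open T" "V = {x. \<forall>i\<ge>n. x i = 0} \<inter> T"
        using V(3) unfolding Euclidean_space_eq_top_of_set openin_open by auto
      have "openin (Euclidean_space m) {w \<in> W. f w \<in> T}"
        by (rule openin_Euclidean_space_preimage[OF W smooth_map_continuous_on[OF U W f] T(1)])
      moreover have "f w \<in> U" if "w \<in> W" for w using f that by (auto simp: smooth_map_def)
      then have "{w \<in> W. f w \<in> T} = ?W"
        using T(2) openin_Euclidean_space_subset[OF U] by blast
      ultimately show ?thesis by simp
    qed
    have fW: "smooth_map m ?W n V f"
      by (rule smooth_map_subset[OF f W W']) auto
    have "smooth_terms P m ?W (map (\<lambda>(r, x). (r \<circ> f, x \<circ> f)) xs)"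
      unfolding smooth_terms_def
    proof (clarsimp simp: o_def)
      fix r x assume "(r, x) \<in> set xs"
      then have "smooth_fun n V r" "P n V x" using V(4) by (auto simp: smooth_terms_def)
      then show "smooth_fun m ?W (\<lambda>w. r (f w)) \<and> P m ?W (\<lambda>w. x (f w))"
        using smooth_fun_compose[OF V(3) W' _ fW] plot_comp[OF _ W' fW] by (simp add: o_def)
    qed
    moreover have "\<forall>w\<in>?W. (p \<circ> f) w = combination (map (\<lambda>(r, x). (r \<circ> f, x \<circ> f)) xs) w"
      using V(5) by (simp add: combination_comp)
    ultimately show "\<exists>V xs. w \<in> V \<and> V \<subseteq> W \<and> openin (Euclidean_space m) V \<and>
        smooth_terms P m V xs \<and> (\<forall>v\<in>V. (p \<circ> f) v = combination xs v)"
      using w V(1) W' by (intro exI[of _ ?W] exI conjI) (assumption | simp | blast)+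
  qed (rule W)
next
  fix n U v assume U: "openin (Euclidean_space n) U" and v: "v \<in> free_vs X"
  obtain ks where ks: "set ks = Poly_Mapping.keys v" "distinct ks"
    using finite_distinct_list[OF finite_keys[of v]] by auto
  \<comment> \<open>The expansion of \<open>v\<close> in its own basis vectors, with constant
    coefficients and constant points.\<close>
  define xs :: "(((nat \<Rightarrow> real) \<Rightarrow> real) \<times> ((nat \<Rightarrow> real) \<Rightarrow> 'a)) list"
    where "xs = map (\<lambda>x. (\<lambda>_. Poly_Mapping.lookup v x, \<lambda>_. x)) ks"
  show "combination_plots P n U (\<lambda>_. v)"
  proof (rule combination_plotsI[OF U])
    have "set ks \<subseteq> X" using v ks by (auto simp: free_vs_def)
    then show "smooth_terms P n U xs"
      using plot_const[OF U] smooth_fun_const[OF U] by (auto simp: smooth_terms_def xs_def)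
    have "combination xs u = (\<Sum>x\<leftarrow>ks. Poly_Mapping.lookup v x *\<^sub>R free_basis x)" for u
      by (simp add: combination_def xs_def o_def case_prod_unfold)
    then show "v = combination xs u" for u
      using poly_mapping_eq_sum_free_basis[of "set ks" v] ks by (simp add: sum_list_distinct_conv_sum_set)
  qed
next
  fix \<U> n p assume \<U>: "\<And>U. U \<in> \<U> \<Longrightarrow> combination_plots P n U p"
  then have "openin (Euclidean_space n) (\<Union>\<U>)"
    by (intro openin_Union) (auto simp: combination_plots_def)
  with \<U> show "combination_plots P n (\<Union>\<U>) p"
    unfolding combination_plots_def by (meson UnionE Union_upper order_trans)
qed

lemma smooth_fun_block_scalar:
  "openin (Euclidean_space N) D \<Longrightarrow> smooth_fun N D (block_scalar k i)"
  unfolding block_scalar_def by (rule smooth_fun_coordinate)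

lemma free_generators_domain:
  assumes "\<And>i. i < n \<Longrightarrow> P (k i) (U i) (p i)"
  shows "openin (Euclidean_space N) {z \<in> topspace (Euclidean_space N). \<forall>i<n. block_point k i z \<in> U i}"
    (is "openin _ ?D")
proof -
  have T: "openin (Euclidean_space N) {x. \<forall>i\<ge>N. x i = 0}"
    by (metis openin_topspace topspace_Euclidean_space)
  have "openin (Euclidean_space N) {z \<in> topspace (Euclidean_space N). block_point k i z \<in> U i}" if i: "i < n" for i
  proof -
    obtain T' where T': "open T'" "U i = {x. \<forall>j\<ge>k i. x j = 0} \<inter> T'"
      using plot_open[OF assms(1)[OF i]] unfolding Euclidean_space_eq_top_of_set openin_open by auto
    have "continuous_on S (block_point k i)" for S
    proof (rule continuous_on_coordinatewise_then_product)
      show "continuous_on S (\<lambda>z. block_point k i z j)" for j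
        by (cases "j < k i") (auto simp: block_point_def intro: continuous_on_subset[OF continuous_on_product_coordinates])
    qed
    from openin_Euclidean_space_preimage[OF T this T'(1)]
    have "openin (Euclidean_space N) {x \<in> {x. \<forall>i\<ge>N. x i = 0}. block_point k i x \<in> T'}" .
    \<comment> \<open>\<open>block_point\<close> pads with zeros from \<open>k i\<close> on, so
      membership in the coordinate subspace is automatic and only \<open>T'\<close> remains.\<close>
    moreover have "block_point k i x \<in> U i \<longleftrightarrow> block_point k i x \<in> T'" for x
      unfolding T'(2) by (auto simp: block_point_def)
    ultimately show ?thesis by (simp add: topspace_Euclidean_space)
  qed
  \<comment> \<open>The last factor keeps the identity true for \<open>n = 0\<close>, where the
    intersection is the whole type.\<close>
  moreover have "?D = (\<Inter>i<n. {z \<in> topspace (Euclidean_space N). block_point k i z \<in> U i}) \<inter> topspace (Euclidean_space N)"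
    by auto
  ultimately show ?thesis
    by (cases "n = 0") (auto intro!: openin_Int openin_INT2)
qed

lemma smooth_map_block_point:
  assumes "openin (Euclidean_space N) D" "\<And>z. z \<in> D \<Longrightarrow> block_point k i z \<in> U"
  shows "smooth_map N D (k i) U (block_point k i)"
  using assms by (auto simp: smooth_map_def block_point_def intro: smooth_fun_coordinate)

lemma plot_block:
  assumes "openin (Euclidean_space N) D" "P (k i) U p" "\<And>z. z \<in> D \<Longrightarrow> block_point k i z \<in> U"
  shows "P N D (\<lambda>z. p (block_point k i z))"
  using plot_comp[OF assms(2,1) smooth_map_block_point[OF assms(1,3)]] by (simp add: o_def)

text \<open>A generator is one combination on its whole domain: term \<open>i\<close> pairs the
  coordinate \<open>block_scalar k i\<close> with the pullback of \<open>p i\<close> along the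
  projection to its block.\<close>

lemma free_generators_combination_plots:
  assumes "free_generators P N D q"
  shows "combination_plots P N D q"
proof -
  obtain n k U p where *: "\<And>i. i < n \<Longrightarrow> P (k i) (U i) (p i)"
      "D = {z \<in> topspace (Euclidean_space N). \<forall>i<n. block_point k i z \<in> U i}"
      "q = (\<lambda>z. \<Sum>i<n. block_scalar k i z *\<^sub>R free_basis (p i (block_point k i z)))"
    using assms unfolding free_generators_def by blast
  have D: "openin (Euclidean_space N) D"
    unfolding *(2) by (rule free_generators_domain[OF *(1)])
  have "P N D (\<lambda>z. p i (block_point k i z))" if "i < n" for i
    by (rule plot_block[where k = k and i = i and p = "p i" and U = "U i", OF D *(1)[OF that]])
      (use *(2) that in blast)
  note plot = this
  show ?thesis
  proof (rule combination_plotsI[OF D])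
    show "smooth_terms P N D (map (\<lambda>i. (block_scalar k i, \<lambda>z. p i (block_point k i z))) [0..<n])"
      using plot by (auto simp: smooth_terms_def smooth_fun_block_scalar[OF D])
    show "q z = combination (map (\<lambda>i. (block_scalar k i, \<lambda>z. p i (block_point k i z))) [0..<n]) z" for z
      by (simp add: *(3) combination_def o_def interv_sum_list_conv_sum_set_nat atLeast0LessThan)
  qed
qed

lemma diffeological_space_free_plots: "diffeological_space (free_vs X) (free_plots X P)"
  unfolding free_plots_def
proof (rule diffeological_space_generated_plots)
  fix n U p assume "free_generators P n U p"
  then have "combination_plots P n U p" by (rule free_generators_combination_plots)
  then show "openin (Euclidean_space n) U \<and> p \<in> U \<rightarrow> free_vs X"
    using diffeological_space.plot_open[OF diffeological_space_combination_plots]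
      diffeological_space.plot_into[OF diffeological_space_combination_plots] by blast
qed

lemma block_start_const: "block_start (\<lambda>_. n) i = i * Suc n"
  by (simp add: block_start_def)

text \<open>The plot \<open>u \<mapsto> r\<^sub>0(u) [x\<^sub>0(u)] + \<dots>\<close> is the pullback of a generator along
  \<open>u \<mapsto> (r\<^sub>0(u), u, r\<^sub>1(u), u, \<dots>)\<close>.\<close>

lemma combination_free_plot:
  assumes U: "openin (Euclidean_space n) U" and xs: "smooth_terms P n U xs"
  shows "free_plots X P n U (combination xs)"
proof (cases "xs = []")
  \<comment> \<open>Generators have at least one term, so the empty combination is treated as a
    constant plot.\<close>
  case True
  then have "combination xs = (\<lambda>_. 0)" by (simp add: combination_Nil fun_eq_iff)
  then show ?thesis
    using diffeological_space.plot_const[OF diffeological_space_free_plots U subspace_0[OF subspace_free_vs]] by simp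
next
  case False
  let ?N = "length xs" and ?k = "\<lambda>_::nat. n"
  define D where "D = {z \<in> topspace (Euclidean_space (block_start ?k ?N)). \<forall>i<?N. block_point ?k i z \<in> U}"
  define q where "q = (\<lambda>z. \<Sum>i<?N. block_scalar ?k i z *\<^sub>R free_basis (snd (xs ! i) (block_point ?k i z)))"
  \<comment> \<open>All blocks have length \<open>Suc n\<close>. The slot \<open>j\<close> belongs
    to block \<open>j div Suc n\<close>; remainder 0 is the scalar slot, and remainder
    \<open>l + 1\<close> holds coordinate \<open>l\<close> of \<open>u\<close>. The zeros at the end
    place \<open>F u\<close> in the space of the right dimension.\<close>
  define F where "F u j = (if j < ?N * Suc n then
      if j mod Suc n = 0 then fst (xs ! (j div Suc n)) u else u (j mod Suc n - 1) else 0)"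
    for u :: "nat \<Rightarrow> real" and j
  have coeffs: "smooth_fun n U (fst (xs ! i))" "P n U (snd (xs ! i))" if "i < ?N" for i
    using xs nth_mem[OF that] by (auto simp: smooth_terms_def case_prod_unfold)
  have gen: "free_generators P (block_start ?k ?N) D q"
    unfolding free_generators_def
    by (rule exI[of _ ?N], rule exI[of _ ?k], rule exI[of _ "\<lambda>_. U"], rule exI[of _ "\<lambda>i. snd (xs ! i)"])
      (use False coeffs in \<open>auto simp: D_def q_def Suc_le_eq\<close>)
  have idx: "i * Suc n + l < ?N * Suc n" if "i < ?N" "l < Suc n" for i l
  proof -
    have "i * Suc n + l < Suc i * Suc n" using that(2) by simp
    also have "\<dots> \<le> ?N * Suc n" using that(1) by (intro mult_le_mono1) simp
    finally show ?thesis .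
  qed
  have scalar: "block_scalar ?k i (F u) = fst (xs ! i) u" if "i < ?N" for i u
    using idx[OF that, of 0] by (simp add: block_scalar_def block_start_const F_def del: mult_Suc_right)
  have point: "block_point ?k i (F u) = u" if "i < ?N" "u \<in> U" for i u
  proof
    fix j
    show "block_point ?k i (F u) j = u j"
    proof (cases "j < n")
      case True
      have "(i * Suc n + Suc j) mod Suc n = Suc j"
        using True by (simp del: mult_Suc_right)
      then have "F u (i * Suc n + Suc j) = u j"
        using idx[OF that(1), of "Suc j"] True by (simp add: F_def del: mult_Suc_right)
      then show ?thesis using True by (simp add: block_point_def block_start_const)
    next
      case False
      then show ?thesis using openin_Euclidean_space_subset[OF U that(2)] by (simp add: block_point_def)
    qed
  qed
  have F: "smooth_map n U (block_start ?k ?N) D F"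
    unfolding smooth_map_def
  proof (intro conjI allI impI)
    show "F \<in> U \<rightarrow> D"
      using point by (auto simp: D_def topspace_Euclidean_space block_start_const F_def)
    fix j assume "j < block_start ?k ?N"
    then have j: "j < ?N * Suc n" by (simp only: block_start_const)
    then have "j div Suc n < ?N" by (simp add: less_mult_imp_div_less)
    then show "smooth_fun n U (\<lambda>u. F u j)"
      using coeffs(1) smooth_fun_coordinate[OF U] j by (cases "j mod Suc n = 0") (simp_all add: F_def)
  qed
  have "free_plots X P n U (q \<circ> F)"
    using generated_plots_generator[where G = "free_generators P", OF gen] unfolding free_plots_def
    by (rule diffeological_space.plot_comp[OF diffeological_space_free_plots[unfolded free_plots_def] _ U F])
  moreover have "combination xs u = (q \<circ> F) u" if "u \<in> U" for u
  proof -
    have "combination xs u = (\<Sum>i<?N. fst (xs ! i) u *\<^sub>R free_basis (snd (xs ! i) u))"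
      by (simp add: combination_def sum_list_sum_nth case_prod_unfold atLeast0LessThan)
    also have "\<dots> = (q \<circ> F) u"
      unfolding q_def o_def by (rule sum.cong) (auto simp: scalar point[OF _ that])
    finally show ?thesis .
  qed
  ultimately show ?thesis
    by (rule diffeological_space.plot_cong[OF diffeological_space_free_plots])
qed

text \<open>One inclusion is the minimality of the generated diffeology. The other glues local
  combinations, each of which is a pullback of a generator.\<close>

lemma free_plots_eq: "free_plots X P = combination_plots P"
proof (intro ext iffI)
  fix n U p
  show "combination_plots P n U p" if "free_plots X P n U p"
    using generated_plots_induct[OF that[unfolded free_plots_def] diffeological_space_combination_plots]
      free_generators_combination_plots by blast
  show "free_plots X P n U p" if p: "combination_plots P n U p"
  proof (rule diffeological_space.plot_local[OF diffeological_space_free_plots])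
    fix u assume "u \<in> U"
    then obtain V xs where V: "u \<in> V" "V \<subseteq> U" "openin (Euclidean_space n) V" "smooth_terms P n V xs"
        "\<And>v. v \<in> V \<Longrightarrow> p v = combination xs v"
      using p unfolding combination_plots_def by blast
    have "free_plots X P n V p"
      using diffeological_space.plot_cong[OF diffeological_space_free_plots combination_free_plot[OF V(3,4)] V(5)] .
    then show "\<exists>V. u \<in> V \<and> V \<subseteq> U \<and> free_plots X P n V p" using V by blast
  qed
qed

lemma combination_plots_add:
  assumes p: "combination_plots P n U p" and q: "combination_plots P n U q"
  shows "combination_plots P n U (\<lambda>u. p u + q u)"
  unfolding combination_plots_def
proof (intro conjI ballI)
  show "openin (Euclidean_space n) U" using p by (simp add: combination_plots_def)
  fix u assume u: "u \<in> U"
  from u p obtain V xs where V: "u \<in> V" "V \<subseteq> U" "openin (Euclidean_space n) V" "smooth_terms P n V xs"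
      "\<And>v. v \<in> V \<Longrightarrow> p v = combination xs v"
    unfolding combination_plots_def by blast
  from u q obtain W ys where W: "u \<in> W" "W \<subseteq> U" "openin (Euclidean_space n) W" "smooth_terms P n W ys"
      "\<And>v. v \<in> W \<Longrightarrow> q v = combination ys v"
    unfolding combination_plots_def by blast
  have VW: "openin (Euclidean_space n) (V \<inter> W)" using V(3) W(3) by (rule openin_Int)
  have "smooth_terms P n (V \<inter> W) (xs @ ys)"
    using smooth_terms_subset[OF V(4,3) VW] smooth_terms_subset[OF W(4,3) VW]
    by (auto simp: smooth_terms_def)
  moreover have "\<forall>v\<in>V \<inter> W. p v + q v = combination (xs @ ys) v"
    using V(5) W(5) by (simp add: combination_append)
  ultimately show "\<exists>V xs. u \<in> V \<and> V \<subseteq> U \<and> openin (Euclidean_space n) V \<and>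
      smooth_terms P n V xs \<and> (\<forall>v\<in>V. p v + q v = combination xs v)"
    using V(1,2) W(1) VW by (intro exI[of _ "V \<inter> W"] exI[of _ "xs @ ys"]) blast
qed

lemma combination_plots_scaleR:
  assumes s: "smooth_fun n U s" and p: "combination_plots P n U p"
  shows "combination_plots P n U (\<lambda>u. s u *\<^sub>R p u)"
  unfolding combination_plots_def
proof (intro conjI ballI)
  show U: "openin (Euclidean_space n) U" using p by (simp add: combination_plots_def)
  fix u assume u: "u \<in> U"
  from u p obtain V xs where V: "u \<in> V" "V \<subseteq> U" "openin (Euclidean_space n) V" "smooth_terms P n V xs"
      "\<And>v. v \<in> V \<Longrightarrow> p v = combination xs v"
    unfolding combination_plots_def by blast
  let ?ys = "map (\<lambda>(r, x). (\<lambda>u. s u * r u, x)) xs"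
  have "smooth_terms P n V ?ys"
    using V(4) smooth_fun_mult[OF V(3) smooth_fun_subset[OF V(3,2) U s]]
    unfolding smooth_terms_def by auto
  moreover have "\<forall>v\<in>V. s v *\<^sub>R p v = combination ?ys v"
    using V(5) by (simp add: combination_scale)
  ultimately show "\<exists>V xs. u \<in> V \<and> V \<subseteq> U \<and> openin (Euclidean_space n) V \<and>
      smooth_terms P n V xs \<and> (\<forall>v\<in>V. s v *\<^sub>R p v = combination xs v)"
    using V(1,2,3) by blast
qed

text \<open>In terms of local combinations, addition concatenates the lists of terms and scaling
  multiplies their coefficients.\<close>

lemma diffeological_vector_space_free: "diffeological_vector_space (free_vs X) (free_plots X P)"
proof -
  have "smooth_between (free_vs X \<times> free_vs X) (prod_plots (free_plots X P) (free_plots X P))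
      (free_vs X) (free_plots X P) (\<lambda>(x, y). x + y)"
    unfolding smooth_between_def free_plots_eq
  proof (intro conjI allI impI)
    fix n U and p :: "(nat \<Rightarrow> real) \<Rightarrow> ('a \<Rightarrow>\<^sub>0 real) \<times> ('a \<Rightarrow>\<^sub>0 real)"
    assume "prod_plots (combination_plots P) (combination_plots P) n U p"
    then show "combination_plots P n U ((\<lambda>(x, y). x + y) \<circ> p)"
      using combination_plots_add[of n U "fst \<circ> p" "snd \<circ> p"]
      by (simp add: prod_plots_def o_def case_prod_unfold)
  qed (auto intro: subspace_add[OF subspace_free_vs])
  moreover have "smooth_between (UNIV \<times> free_vs X) (prod_plots real_plots (free_plots X P))
      (free_vs X) (free_plots X P) (\<lambda>(r, x). r *\<^sub>R x)"
    unfolding smooth_between_def free_plots_eq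
  proof (intro conjI allI impI)
    fix n U and p :: "(nat \<Rightarrow> real) \<Rightarrow> real \<times> ('a \<Rightarrow>\<^sub>0 real)"
    assume "prod_plots real_plots (combination_plots P) n U p"
    then show "combination_plots P n U ((\<lambda>(r, x). r *\<^sub>R x) \<circ> p)"
      using combination_plots_scaleR[of n U "fst \<circ> p" "snd \<circ> p"]
      by (simp add: prod_plots_def real_plots_def o_def case_prod_unfold)
  qed (auto intro: subspace_scale[OF subspace_free_vs])
  ultimately show ?thesis
    by (simp add: diffeological_vector_space_def subspace_free_vs diffeological_space_free_plots)
qed

text \<open>A combination with a single term of coefficient 1. In other words, x -> [x] is
  smooth.\<close>

lemma free_plot_free_basis:
  assumes "P n U p" shows "free_plots X P n U (\<lambda>u. free_basis (p u))"
  unfolding free_plots_eq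
  by (rule combination_plotsI[where xs = "[(\<lambda>_. 1, p)]"])
    (use assms plot_open[OF assms] in \<open>auto simp: smooth_terms_def smooth_fun_const combination_def\<close>)

end

section \<open>The universal property of the free space\<close>

definition free_extension :: "('a \<Rightarrow> 'w::real_vector) \<Rightarrow> ('a \<Rightarrow>\<^sub>0 real) \<Rightarrow> 'w" where
  "free_extension h v = (\<Sum>x\<in>Poly_Mapping.keys v. Poly_Mapping.lookup v x *\<^sub>R h x)"

text \<open>Keys can cancel in a sum of vectors. A common finite set containing all keys makes the
  expansions comparable term by term.\<close>

lemma free_extension_eq:
  "finite S \<Longrightarrow> Poly_Mapping.keys v \<subseteq> S \<Longrightarrow>
    free_extension h v = (\<Sum>x\<in>S. Poly_Mapping.lookup v x *\<^sub>R h x)"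
  unfolding free_extension_def by (rule sum.mono_neutral_left) (auto simp: in_keys_iff)

lemma linear_free_extension: "linear (free_extension h)"
proof (rule linearI)
  fix v w :: "'a \<Rightarrow>\<^sub>0 real" and r :: real
  let ?S = "Poly_Mapping.keys v \<union> Poly_Mapping.keys w"
  have "Poly_Mapping.keys (v + w) \<subseteq> ?S" by (rule keys_add)
  then show "free_extension h (v + w) = free_extension h v + free_extension h w"
    by (simp add: free_extension_eq[of ?S] lookup_add scaleR_add_left sum.distrib)
  have "Poly_Mapping.keys (r *\<^sub>R v) \<subseteq> Poly_Mapping.keys v"
    by (auto simp: in_keys_iff lookup_scaleR)
  then show "free_extension h (r *\<^sub>R v) = r *\<^sub>R free_extension h v"
    by (simp add: free_extension_eq[of "Poly_Mapping.keys v"] lookup_scaleR scaleR_sum_right)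
qed

lemma free_extension_free_basis: "free_extension h (free_basis x) = h x"
  by (simp add: free_extension_def)

text \<open>Locally a plot is a list of terms \<open>(r, x)\<close>. The extension sends it to the
  sum of the maps \<open>r\<close> times \<open>h \<circ> x\<close>, which is a plot because the
  operations of \<open>W\<close> are smooth.\<close>

lemma (in diffeological_space) smooth_linear_free_extension:
  assumes W: "diffeological_vector_space W Q" and h: "smooth_between X P W Q h"
  shows "smooth_linear (free_vs X) (free_plots X P) W Q (free_extension h)"
proof -
  have into: "free_extension h v \<in> W" if "v \<in> free_vs X" for v
    unfolding free_extension_def
    using h that by (intro subspace_sum subspace_scale dvs_subspace[OF W])
      (auto simp: smooth_between_def free_vs_def)
  have "Q n U (free_extension h \<circ> p)" if "combination_plots P n U p" for n U p
  proof (rule diffeological_space.plot_local[OF dvs_diffeological_space[OF W]])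
    fix u assume "u \<in> U"
    then obtain V xs where V: "u \<in> V" "V \<subseteq> U" "openin (Euclidean_space n) V" "smooth_terms P n V xs"
        "\<And>v. v \<in> V \<Longrightarrow> p v = combination xs v"
      using \<open>combination_plots P n U p\<close> unfolding combination_plots_def by blast
    have "Q n V (\<lambda>v. free_extension h (combination xs v))"
      using V(4)
    proof (induction xs)
      case Nil
      then show ?case
        by (simp add: combination_Nil linear_0[OF linear_free_extension]
            diffeological_space.plot_const[OF dvs_diffeological_space[OF W] V(3)] subspace_0[OF dvs_subspace[OF W]])
    next
      case (Cons rx xs)
      then have rx: "smooth_fun n V (fst rx)" "P n V (snd rx)" and xs: "smooth_terms P n V xs"
        by (auto simp: smooth_terms_def case_prod_unfold)
      have "Q n V (h \<circ> snd rx)" using h rx(2) by (simp add: smooth_between_def)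
      from dvs_plot_add[OF W, OF dvs_plot_scaleR[OF W, OF V(3) rx(1) this] Cons.IH[OF xs]]
      have *: "Q n V (\<lambda>v. fst rx v *\<^sub>R h (snd rx v) + free_extension h (combination xs v))"
        by (simp only: o_def)
      show ?case
        by (rule diffeological_space.plot_cong[OF dvs_diffeological_space[OF W], OF *])
          (simp add: combination_Cons linear_add[OF linear_free_extension]
            linear_scale[OF linear_free_extension] free_extension_free_basis)
    qed
    then have "Q n V (free_extension h \<circ> p)"
      by (rule diffeological_space.plot_cong[OF dvs_diffeological_space[OF W]]) (simp add: V(5))
    then show "\<exists>V. u \<in> V \<and> V \<subseteq> U \<and> Q n V (free_extension h \<circ> p)" using V by blast
  qed
  then show ?thesis
    using into unfolding smooth_linear_def smooth_between_def free_plots_eq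
    by (auto simp: linear_add[OF linear_free_extension] linear_scale[OF linear_free_extension])
qed

text \<open>The map is linear only on a subspace, so the induction keeps every partial sum inside
  \<open>W\<close>.\<close>

lemma additive_homogeneous_sum:
  fixes f :: "'v::real_vector \<Rightarrow> 'w::real_vector"
  assumes "subspace W" "\<And>v w. v \<in> W \<Longrightarrow> w \<in> W \<Longrightarrow> f (v + w) = f v + f w"
    and "\<And>r v. v \<in> W \<Longrightarrow> f (r *\<^sub>R v) = r *\<^sub>R f v"
  shows "finite I \<Longrightarrow> (\<And>i. i \<in> I \<Longrightarrow> v i \<in> W) \<Longrightarrow>
    f (\<Sum>i\<in>I. r i *\<^sub>R v i) = (\<Sum>i\<in>I. r i *\<^sub>R f (v i))"
proof (induction I rule: finite_induct)
  case empty
  \<comment> \<open>\<open>f 0 = 0\<close> is homogeneity with the scalar 0.\<close>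
  show ?case
    using assms(3)[OF subspace_0[OF assms(1)], of 0] by (simp only: scaleR_zero_left sum.empty)
next
  case (insert i I)
  have "(\<Sum>i\<in>I. r i *\<^sub>R v i) \<in> W" "r i *\<^sub>R v i \<in> W"
    using insert.prems assms(1) by (auto intro!: subspace_sum subspace_scale)
  then show ?case
    using insert assms(2,3) by simp
qed

lemma eq_free_extension:
  fixes g :: "('a \<Rightarrow>\<^sub>0 real) \<Rightarrow> 'w::real_vector"
  assumes "\<And>v w. v \<in> free_vs X \<Longrightarrow> w \<in> free_vs X \<Longrightarrow> g (v + w) = g v + g w"
    and "\<And>r v. v \<in> free_vs X \<Longrightarrow> g (r *\<^sub>R v) = r *\<^sub>R g v" and v: "v \<in> free_vs X"
  shows "g v = free_extension (\<lambda>x. g (free_basis x)) v"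
proof -
  have "g (\<Sum>x\<in>Poly_Mapping.keys v. Poly_Mapping.lookup v x *\<^sub>R free_basis x) =
      free_extension (\<lambda>x. g (free_basis x)) v"
    unfolding free_extension_def
    by (rule additive_homogeneous_sum[OF subspace_free_vs assms(1,2) finite_keys])
      (use v in \<open>auto simp: free_vs_def\<close>)
  then show ?thesis
    by (simp only: poly_mapping_eq_sum_free_basis[OF finite_keys order_refl, symmetric])
qed

section \<open>Smooth partitions of unity\<close>

context smooth_manifold
begin

sublocale diffeological_space "topspace M" "manifold_plots n M A"
  by (rule diffeological_space_manifold_plots) unfold_locales

lemma openin_plot_preimage:
  assumes "manifold_plots n M A m U p" "openin M S"
  shows "openin (Euclidean_space m) {u \<in> U. p u \<in> S}"
  using assms by (intro openin_continuous_preimage_Euclidean_space) (auto simp: manifold_plots_def)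

lemma chart_inj_on: "(W, \<phi>) \<in> A \<Longrightarrow> inj_on \<phi> W"
  using homeomorphic_imp_injective_map[OF chart_homeo] openin_subset[OF chart_domain]
  by (metis topspace_subtopology_subset)

text \<open>\<open>homeomorphic_map\<close> yields some continuous inverse. On the image it agrees
  with \<open>inv_into W \<phi>\<close>, the inverse that occurs in
  \<open>charts_compatible\<close>.\<close>

lemma chart_inverse_continuous_map:
  assumes A: "(W, \<phi>) \<in> A"
  shows "continuous_map (subtopology (Euclidean_space n) (\<phi> ` W)) (subtopology M W) (inv_into W \<phi>)"
proof -
  have W: "topspace (subtopology M W) = W"
    using openin_subset[OF chart_domain[OF A]] by auto
  have \<phi>W: "topspace (subtopology (Euclidean_space n) (\<phi> ` W)) = \<phi> ` W"
    using openin_subset[OF chart_image[OF A]] by auto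
  obtain g where g: "homeomorphic_maps (subtopology M W) (subtopology (Euclidean_space n) (\<phi> ` W)) \<phi> g"
    using chart_homeo[OF A] homeomorphic_map_maps by blast
  then have "continuous_map (subtopology (Euclidean_space n) (\<phi> ` W)) (subtopology M W) g"
    by (simp add: homeomorphic_maps_def)
  then show ?thesis
  proof (rule continuous_map_eq)
    fix y assume "y \<in> topspace (subtopology (Euclidean_space n) (\<phi> ` W))"
    then obtain w where w: "w \<in> W" "y = \<phi> w" using \<phi>W by auto
    then have "g y = w" using g W by (simp add: homeomorphic_maps_def)
    then show "g y = inv_into W \<phi> y" using w inv_into_f_f[OF chart_inj_on[OF A]] by simp
  qed
qed

text \<open>Over another chart domain the inverse chart becomes a transition map, so this is where
  compatibility of the atlas enters. It turns a smooth map on M into a plot on a Euclidean open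
  set.\<close>

lemma chart_inverse_plot:
  assumes A: "(W, \<phi>) \<in> A"
  shows "manifold_plots n M A n (\<phi> ` W) (inv_into W \<phi>)"
proof -
  have "smooth_map n {u \<in> \<phi> ` W. inv_into W \<phi> u \<in> W'} n (\<psi> ` W') (\<psi> \<circ> inv_into W \<phi>)"
    if A': "(W', \<psi>) \<in> A" for W' \<psi>
  proof -
    have *: "{u \<in> \<phi> ` W. inv_into W \<phi> u \<in> W'} = \<phi> ` (W \<inter> W')"
      using inv_into_f_f[OF chart_inj_on[OF A]] by auto
    show ?thesis
      unfolding * using charts_compatible[OF A A'] by (auto simp: smooth_map_def)
  qed
  moreover have "continuous_map (subtopology (Euclidean_space n) (\<phi> ` W)) M (inv_into W \<phi>)"
    using chart_inverse_continuous_map[OF A] by (rule continuous_map_into_fulltopology)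
  ultimately show ?thesis
    using chart_image[OF A] by (auto simp: manifold_plots_def)
qed

lemma chart_open_image:
  assumes A: "(W, \<phi>) \<in> A" and S: "openin M S" "S \<subseteq> W"
  shows "openin (Euclidean_space n) (\<phi> ` S)"
proof -
  have "openin (Euclidean_space n) {u \<in> \<phi> ` W. inv_into W \<phi> u \<in> S}"
    by (rule openin_plot_preimage[OF chart_inverse_plot[OF A] S(1)])
  moreover have "{u \<in> \<phi> ` W. inv_into W \<phi> u \<in> S} = \<phi> ` S"
    using S(2) inv_into_f_f[OF chart_inj_on[OF A]] by fastforce
  ultimately show ?thesis by simp
qed

lemma chart_open_preimage:
  assumes A: "(W, \<phi>) \<in> A" and V: "openin (Euclidean_space n) V" "V \<subseteq> \<phi> ` W"
  shows "openin M {y \<in> W. \<phi> y \<in> V}"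
proof -
  have W: "topspace (subtopology M W) = W"
    using openin_subset[OF chart_domain[OF A]] by auto
  have "openin (subtopology (Euclidean_space n) (\<phi> ` W)) V"
    using openin_open_subtopology[OF chart_image[OF A]] V by blast
  then have "openin (subtopology M W) {y \<in> topspace (subtopology M W). \<phi> y \<in> V}"
    by (rule openin_continuous_map_preimage[OF homeomorphic_imp_continuous_map[OF chart_homeo[OF A]]])
  then show ?thesis
    unfolding W using openin_trans_full[OF _ chart_domain[OF A]] by blast
qed

abbreviation smooth_real :: "('a \<Rightarrow> real) \<Rightarrow> bool" where
  "smooth_real \<equiv> smooth_between (topspace M) (manifold_plots n M A) UNIV real_plots"

lemma smooth_realD:
  assumes "smooth_real \<beta>" "manifold_plots n M A m U p"
  shows "smooth_fun m U (\<lambda>u. \<beta> (p u))"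
  using assms by (auto simp: smooth_between_def real_plots_def o_def)

lemma smooth_realI:
  assumes "\<And>m U p. manifold_plots n M A m U p \<Longrightarrow> smooth_fun m U (\<lambda>u. \<beta> (p u))"
  shows "smooth_real \<beta>"
  using assms plot_open by (auto simp: smooth_between_def real_plots_def o_def)

text \<open>In a chart, \<open>flat_fun 1\<close> of a squared radius minus the squared distance to
  the image of \<open>x\<close>, continued by 0. The continuation is smooth because the function
  vanishes off a compact subset of the chart domain, which is closed in the Hausdorff space
  \<open>M\<close>.\<close>

lemma bump_function:
  assumes S: "openin M S" and x: "x \<in> S"
  obtains N K \<beta> where "openin M N" "x \<in> N" "closedin M K" "K \<subseteq> S" "smooth_real \<beta>"
    "\<And>y. \<beta> y \<ge> 0" "\<And>y. y \<in> N \<Longrightarrow> \<beta> y > 0" "\<And>y. y \<notin> K \<Longrightarrow> \<beta> y = 0"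
proof -
  have "x \<in> topspace M" using S x openin_subset by blast
  then obtain W \<phi> where A: "(W, \<phi>) \<in> A" and xW: "x \<in> W" using charts_cover by auto
  note inv = inv_into_f_f[OF chart_inj_on[OF A]]
  have \<phi>0: "\<phi> y j = 0" if "y \<in> W" "j \<ge> n" for y j
    using openin_Euclidean_space_subset[OF chart_image[OF A]] that by blast
  let ?a = "\<phi> x"
  have SW: "openin (Euclidean_space n) (\<phi> ` (W \<inter> S))"
    using openin_Int[OF chart_domain[OF A] S] by (intro chart_open_image[OF A]) auto
  obtain e where e: "e > 0"
    "\<And>y. (\<And>j. j \<ge> n \<Longrightarrow> y j = 0) \<Longrightarrow> (\<And>j. j < n \<Longrightarrow> \<bar>y j - ?a j\<bar> < e) \<Longrightarrow> y \<in> \<phi> ` (W \<inter> S)"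
    using openin_Euclidean_space_box[OF SW] xW x by blast
  \<comment> \<open>With the radius halved, the closed cube lies in the open box. It also contains
    the ball of radius \<open>e / 2\<close> in which the bump is positive.\<close>
  define C where "C = {y. (\<forall>j\<ge>n. y j = 0) \<and> (\<forall>j<n. \<bar>y j - ?a j\<bar> \<le> e / 2)}"
  have C: "C \<subseteq> \<phi> ` (W \<inter> S)"
  proof
    fix y assume "y \<in> C"
    then have "\<And>j. j \<ge> n \<Longrightarrow> y j = 0" "\<And>j. j < n \<Longrightarrow> \<bar>y j - ?a j\<bar> \<le> e / 2" by (auto simp: C_def)
    moreover have "e / 2 < e" using e(1) by simp
    ultimately show "y \<in> \<phi> ` (W \<inter> S)" using e(2) by (meson le_less_trans)
  qed
  define d where "d y = (e / 2)\<^sup>2 - (\<Sum>j<n. (y j - ?a j) * (y j - ?a j))" for y :: "nat \<Rightarrow> real"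
  define \<beta> where "\<beta> y = (if y \<in> W then flat_fun 1 (d (\<phi> y)) else 0)" for y
  define K where "K = inv_into W \<phi> ` C"
  define N where "N = {y \<in> W. \<phi> y \<in> {z \<in> \<phi> ` W. d z \<in> {0<..}}}"
  have d_smooth: "smooth_fun n U d" if "openin (Euclidean_space n) U" for U
    unfolding d_def using that
    by (intro smooth_fun_diff smooth_fun_const smooth_fun_sum smooth_fun_mult smooth_fun_coordinate)
  have KW: "K \<subseteq> W \<inter> S" using C inv by (auto simp: K_def subset_iff image_iff) 
  have K: "closedin M K"
  proof -
    have "compactin (Euclidean_space n) C"
      using compact_Euclidean_box[of n ?a "e / 2"]
      by (auto simp: Euclidean_space_eq_top_of_set compactin_subtopology C_def)
    then have "compactin (subtopology (Euclidean_space n) (\<phi> ` W)) C"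
      using C by (auto simp: compactin_subtopology)
    then have "compactin (subtopology M W) K"
      unfolding K_def by (rule image_compactin[OF _ chart_inverse_continuous_map[OF A]])
    then show ?thesis
      using compactin_imp_closedin[OF hausdorff] by (auto simp: compactin_subtopology)
  qed
  have zero: "\<beta> y = 0" if y: "y \<notin> K" for y
  proof (rule ccontr)
    assume "\<beta> y \<noteq> 0"
    then have yW: "y \<in> W" and pos: "d (\<phi> y) > 0"
      by (auto simp: \<beta>_def flat_fun_def split: if_splits)
    have "\<bar>\<phi> y j - ?a j\<bar> \<le> e / 2" if "j < n" for j
    proof -
      have "(\<phi> y j - ?a j)\<^sup>2 \<le> (\<Sum>j<n. (\<phi> y j - ?a j)\<^sup>2)"
        using that by (intro member_le_sum) auto
      also have "\<dots> < (e / 2)\<^sup>2" using pos by (simp add: d_def power2_eq_square)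
      finally show ?thesis
        using e(1) power2_less_imp_less[of "\<bar>\<phi> y j - ?a j\<bar>" "e / 2"] by simp
    qed
    then have "\<phi> y \<in> C" using \<phi>0[OF yW] by (auto simp: C_def)
    then have "y \<in> K" using inv[OF yW] unfolding K_def by (metis imageI)
    with y show False by simp
  qed
  show ?thesis
  proof
    have "openin (Euclidean_space n) {z \<in> \<phi> ` W. d z \<in> {0<..}}"
      using chart_image[OF A] d_smooth by (intro openin_Euclidean_space_preimage smooth_fun_continuous_on) auto
    then show "openin M N" unfolding N_def by (rule chart_open_preimage[OF A]) auto
    show "x \<in> N" using xW e(1) by (auto simp: N_def d_def)
    show "closedin M K" by (rule K)
    show "K \<subseteq> S" using KW by auto
    show "\<beta> y \<ge> 0" for y by (simp add: \<beta>_def flat_fun_1_nonneg)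
    show "\<beta> y > 0" if "y \<in> N" for y using that by (simp add: N_def \<beta>_def flat_fun_1_pos_iff)
    show "\<beta> y = 0" if "y \<notin> K" for y using zero that .
    show "smooth_real \<beta>"
    proof (rule smooth_realI)
      fix m U p assume p: "manifold_plots n M A m U p"
      show "smooth_fun m U (\<lambda>u. \<beta> (p u))"
      proof (rule smooth_fun_local[OF plot_open[OF p]])
        fix u assume u: "u \<in> U"
        show "\<exists>V. u \<in> V \<and> V \<subseteq> U \<and> openin (Euclidean_space m) V \<and> smooth_fun m V (\<lambda>u. \<beta> (p u))"
        \<comment> \<open>The preimages of \<open>W\<close> and of the complement of
          \<open>K\<close> are open and cover \<open>U\<close>: on the first the chart formula is
          smooth, on the second the function is 0.\<close>
        proof (cases "p u \<in> W")
          case True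
          let ?V = "{u \<in> U. p u \<in> W}"
          have V: "openin (Euclidean_space m) ?V"
            by (rule openin_plot_preimage[OF p chart_domain[OF A]])
          have "smooth_map m ?V n (\<phi> ` W) (\<phi> \<circ> p)"
            using p A by (auto simp: manifold_plots_def)
          from smooth_fun_compose[OF chart_image[OF A] V d_smooth[OF chart_image[OF A]] this]
          have "smooth_fun m ?V (\<lambda>u. flat_fun 1 (d (\<phi> (p u))))"
            by (simp add: smooth_fun_flat_fun[OF V])
          then have "smooth_fun m ?V (\<lambda>u. \<beta> (p u))"
            by (rule smooth_fun_cong[OF V]) (simp add: \<beta>_def)
          moreover have "u \<in> ?V" "?V \<subseteq> U" using u True by auto
          ultimately show ?thesis using V by (intro exI[of _ ?V]) (intro conjI)
        next
          case False
          let ?V = "{u \<in> U. p u \<in> topspace M - K}"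
          have V: "openin (Euclidean_space m) ?V"
            by (rule openin_plot_preimage[OF p]) (use K in blast)
          have "smooth_fun m ?V (\<lambda>u. \<beta> (p u))"
            by (rule smooth_fun_cong[OF V smooth_fun_const[OF V, of 0]]) (simp add: zero)
          moreover have "u \<in> ?V" using u False KW funcset_mem[OF plot_into[OF p] u] by blast
          moreover have "?V \<subseteq> U" by blast
          ultimately show ?thesis using V by (intro exI[of _ ?V]) (intro conjI)
        qed
      qed
    qed
  qed
qed

text \<open>Local finiteness is stated along plots, the form in which smoothness is tested. Since
  \<open>K i\<close> is closed in \<open>M\<close> and lies in \<open>S (c i)\<close>, a map given
  on \<open>S (c i)\<close> can be multiplied by \<open>\<rho> i\<close> and continued by 0.\<close>

lemma partition_of_unity:
  assumes S: "\<And>x. x \<in> topspace M \<Longrightarrow> openin M (S x) \<and> x \<in> S x" and ne: "topspace M \<noteq> {}"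
  obtains c K and \<rho> :: "nat \<Rightarrow> 'a \<Rightarrow> real" where
    "\<And>i. c i \<in> topspace M" "\<And>i. closedin M (K i)" "\<And>i. K i \<subseteq> S (c i)"
    "\<And>i. smooth_real (\<rho> i)" "\<And>i y. y \<notin> K i \<Longrightarrow> \<rho> i y = 0"
    "\<And>m U p u. manifold_plots n M A m U p \<Longrightarrow> u \<in> U \<Longrightarrow>
      \<exists>V k. u \<in> V \<and> V \<subseteq> U \<and> openin (Euclidean_space m) V \<and> (\<forall>v\<in>V. \<forall>i\<ge>k. \<rho> i (p v) = 0)"
    "\<And>y. y \<in> topspace M \<Longrightarrow> finite {i. \<rho> i y \<noteq> 0}"
    "\<And>y. y \<in> topspace M \<Longrightarrow> (\<Sum>i | \<rho> i y \<noteq> 0. \<rho> i y) = 1"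
proof -
  define good where "good x \<beta> K N \<longleftrightarrow> openin M N \<and> x \<in> N \<and> closedin M K \<and> K \<subseteq> S x \<and> smooth_real \<beta> \<and>
      (\<forall>y. \<beta> y \<ge> 0) \<and> (\<forall>y\<in>N. \<beta> y > 0) \<and> (\<forall>y. y \<notin> K \<longrightarrow> \<beta> y = 0)" for x \<beta> K N
  have "\<exists>\<beta> K N. good x \<beta> K N" if x: "x \<in> topspace M" for x
  proof (rule bump_function[OF conjunct1[OF S[OF x]] conjunct2[OF S[OF x]]])
    fix N K \<beta> assume "openin M N" "x \<in> N" "closedin M K" "K \<subseteq> S x" "smooth_real \<beta>"
      "\<And>y. \<beta> y \<ge> 0" "\<And>y. y \<in> N \<Longrightarrow> \<beta> y > 0" "\<And>y. y \<notin> K \<Longrightarrow> \<beta> y = 0"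
    then have "good x \<beta> K N" unfolding good_def by blast
    then show ?thesis by blast
  qed
  then obtain \<beta> K N where good: "\<And>x. x \<in> topspace M \<Longrightarrow> good x (\<beta> x) (K x) (N x)"
    by metis
  have bump: "openin M (N x)" "x \<in> N x" "closedin M (K x)" "K x \<subseteq> S x" "smooth_real (\<beta> x)"
      "\<beta> x y \<ge> 0" "y \<in> N x \<Longrightarrow> \<beta> x y > 0" "y \<notin> K x \<Longrightarrow> \<beta> x y = 0"
    if "x \<in> topspace M" for x y
    using good[OF that] unfolding good_def by auto
  have "Lindelof_space M" using second_countable by (rule second_countable_imp_Lindelof_space)
  moreover have "\<Union>(N ` topspace M) = topspace M"
    using bump(1,2) openin_subset by blast
  ultimately obtain \<V> where "countable \<V>" "\<V> \<subseteq> N ` topspace M" "\<Union>\<V> = topspace M"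
    unfolding Lindelof_space_def using bump(1) by (smt (verit) imageE)
  then obtain C where C: "countable C" "C \<subseteq> topspace M" "\<Union>(N ` C) = topspace M"
    using countable_subset_image[of \<V> N "topspace M"] by auto
  have "C \<noteq> {}"
  proof
    assume "C = {}"
    with C(3) have "topspace M = {}" by (simp only: image_empty Union_empty)
    with ne show False by contradiction
  qed
  \<comment> \<open>A finite \<open>C\<close> is listed with repetitions; this is harmless, because
    all sums run over indices and not over points.\<close>
  define c where "c = from_nat_into C"
  have cX: "c i \<in> topspace M" for i
    using from_nat_into[OF \<open>C \<noteq> {}\<close>] C(2) by (auto simp: c_def)
  have cover: "\<exists>i. y \<in> N (c i)" if "y \<in> topspace M" for y
    using that C(3) range_from_nat_into[OF \<open>C \<noteq> {}\<close> C(1)] unfolding c_def by (metis UN_E rangeE)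
  define b where "b i = \<beta> (c i)" for i
  have b0: "b i y \<ge> 0" for i y using bump(6)[OF cX] by (simp add: b_def)
  have bsm: "smooth_real (b i)" for i using bump(5)[OF cX] by (simp add: b_def)
  \<comment> \<open>Once \<open>b j\<close> is bounded below near a point, the \<open>j\<close>-th factor kills all late \<open>\<theta> i\<close> there.\<close>
  define \<theta> where "\<theta> i y = b i y * (\<Prod>j<i. flat_fun 1 (1 / Suc i - b j y))" for i y
  define \<sigma> where "\<sigma> y = (\<Sum>i | \<theta> i y \<noteq> 0. \<theta> i y)" for y
  define \<rho> where "\<rho> i y = \<theta> i y * inverse (\<sigma> y)" for i y
  have \<theta>0: "\<theta> i y \<ge> 0" for i y
    unfolding \<theta>_def by (intro mult_nonneg_nonneg prod_nonneg b0 ballI flat_fun_1_nonneg)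
  have \<theta>zero: "\<theta> i y = 0" if "j < i" "1 / Suc i \<le> b j y" for i j y
  proof -
    have "flat_fun 1 (1 / Suc i - b j y) = 0" using that by (simp add: flat_fun_def)
    then show ?thesis using that(1) by (auto simp: \<theta>_def)
  qed
  have late: "\<exists>k. \<forall>y. b j y \<ge> e \<longrightarrow> (\<forall>i\<ge>k. \<theta> i y = 0)" if e: "e > 0" for e j
  proof -
    obtain k where k: "inverse (Suc k) < e" using reals_Archimedean[OF e] by auto
    \<comment> \<open>From \<open>Suc j\<close> on the product contains the factor of index
      \<open>j\<close>; from \<open>k\<close> on its threshold is below \<open>e\<close>, so that
      factor is 0.\<close>
    have "\<theta> i y = 0" if "b j y \<ge> e" "i \<ge> max k (Suc j)" for i y
    proof (rule \<theta>zero)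
      show "j < i" using that(2) by simp
      have "1 / real (Suc i) \<le> 1 / real (Suc k)" using that(2) by (intro divide_left_mono) auto
      also have "\<dots> < e" using k by (simp only: inverse_eq_divide)
      finally show "1 / real (Suc i) \<le> b j y" using that(1) by linarith
    qed
    then show ?thesis by blast
  qed
  have fin: "finite {i. \<theta> i y \<noteq> 0}" if y: "y \<in> topspace M" for y
  proof -
    obtain j where "y \<in> N (c j)" using cover[OF y] by blast
    then have "b j y > 0" using bump(7)[OF cX] by (simp add: b_def)
    then obtain k where "\<forall>i\<ge>k. \<theta> i y = 0" using late[of "b j y" j] by auto
    then have "{i. \<theta> i y \<noteq> 0} \<subseteq> {..<k}" by (auto simp: not_less[symmetric])
    then show ?thesis by (rule finite_subset) simp
  qed
  have \<sigma>_pos: "\<sigma> y > 0" if y: "y \<in> topspace M" for y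
  proof -
    obtain j where "y \<in> N (c j)" using cover[OF y] by blast
    then have "b j y > 0" using bump(7)[OF cX] by (simp add: b_def)
    \<comment> \<open>Before the least index with a positive bump all bumps are 0, so each factor is
      \<open>flat_fun 1 (1 / Suc i)\<close> and hence positive.\<close>
    define i where "i = (LEAST i. b i y > 0)"
    have i: "b i y > 0" unfolding i_def by (rule LeastI) (rule \<open>b j y > 0\<close>)
    have "b j y = 0" if "j < i" for j
      using not_less_Least[OF that[unfolded i_def]] b0[of j y] by simp
    then have "(\<Prod>j<i. flat_fun 1 (1 / Suc i - b j y)) > 0"
      by (intro prod_pos) (simp add: flat_fun_1_pos_iff)
    then have "\<theta> i y > 0" using i by (simp add: \<theta>_def)
    then show ?thesis unfolding \<sigma>_def
      using fin[OF y] \<theta>0 by (intro sum_pos2[of _ i]) auto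
  qed
  have \<theta>sm: "smooth_real (\<theta> i)" for i
  proof (rule smooth_realI)
    fix m U p assume p: "manifold_plots n M A m U p"
    note U = plot_open[OF p]
    show "smooth_fun m U (\<lambda>u. \<theta> i (p u))"
      unfolding \<theta>_def
      by (intro smooth_fun_mult[OF U] smooth_fun_prod[OF U] smooth_fun_flat_fun[OF U] smooth_fun_diff[OF U]
          smooth_fun_const[OF U] smooth_realD[OF bsm p])
  qed
  have locfin: "\<exists>V k. u \<in> V \<and> V \<subseteq> U \<and> openin (Euclidean_space m) V \<and> (\<forall>v\<in>V. \<forall>i\<ge>k. \<theta> i (p v) = 0)"
    if p: "manifold_plots n M A m U p" and u: "u \<in> U" for m U p u
  proof -
    have "p u \<in> topspace M" using plot_into[OF p] u by auto
    then obtain j where "p u \<in> N (c j)" using cover by blast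
    then have pos: "b j (p u) > 0" using bump(7)[OF cX] by (simp add: b_def)
    \<comment> \<open>Half the value at \<open>p u\<close> is an open condition that gives
      \<open>b j\<close> a uniform lower bound, as \<open>late\<close> requires.\<close>
    let ?V = "{v \<in> U. b j (p v) \<in> {b j (p u) / 2 <..}}"
    have "openin (Euclidean_space m) ?V"
      by (rule openin_Euclidean_space_preimage[OF plot_open[OF p]
            smooth_fun_continuous_on[OF plot_open[OF p] smooth_realD[OF bsm p]]]) simp
    moreover obtain k where "\<And>y i. b j y \<ge> b j (p u) / 2 \<Longrightarrow> i \<ge> k \<Longrightarrow> \<theta> i y = 0"
      using late[of "b j (p u) / 2" j] pos by auto
    then have "\<forall>v\<in>?V. \<forall>i\<ge>k. \<theta> i (p v) = 0" by auto
    moreover have "u \<in> ?V" "?V \<subseteq> U" using u pos by auto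
    ultimately show ?thesis by (intro exI[of _ ?V] exI[of _ k]) (intro conjI)
  qed
  \<comment> \<open>The index set in the definition of \<sigma> varies with the point. Over a fixed
    range, \<sigma> is a fixed finite sum of smooth functions.\<close>
  have \<sigma>_eq: "\<sigma> y = (\<Sum>i<k. \<theta> i y)" if "\<forall>i\<ge>k. \<theta> i y = 0" for y k
    unfolding \<sigma>_def using that by (intro sum.mono_neutral_left) (auto simp: not_less[symmetric])
  show ?thesis
  proof
    show "c i \<in> topspace M" "closedin M (K (c i))" "K (c i) \<subseteq> S (c i)" for i
      using cX bump(3,4)[OF cX] by auto
    show "\<rho> i y = 0" if "y \<notin> K (c i)" for i y
      using bump(8)[OF cX that] by (simp add: \<rho>_def \<theta>_def b_def)
    show "\<exists>V k. u \<in> V \<and> V \<subseteq> U \<and> openin (Euclidean_space m) V \<and> (\<forall>v\<in>V. \<forall>i\<ge>k. \<rho> i (p v) = 0)"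
      if p: "manifold_plots n M A m U p" and u: "u \<in> U" for m U p u
    proof -
      obtain V k where V: "u \<in> V" "V \<subseteq> U" "openin (Euclidean_space m) V" "\<forall>v\<in>V. \<forall>i\<ge>k. \<theta> i (p v) = 0"
        using locfin[OF p u] by blast
      then have "\<forall>v\<in>V. \<forall>i\<ge>k. \<rho> i (p v) = 0" by (simp add: \<rho>_def)
      with V(1-3) show ?thesis by (intro exI[of _ V] exI[of _ k]) (intro conjI)
    qed
    have nz: "{i. \<rho> i y \<noteq> 0} = {i. \<theta> i y \<noteq> 0}" if "y \<in> topspace M" for y
      using \<sigma>_pos[OF that] by (simp add: \<rho>_def)
    then show "finite {i. \<rho> i y \<noteq> 0}" if "y \<in> topspace M" for y
      using fin that by simp
    show "(\<Sum>i | \<rho> i y \<noteq> 0. \<rho> i y) = 1" if y: "y \<in> topspace M" for y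
      unfolding nz[OF y] unfolding \<rho>_def sum_distrib_right[symmetric] \<sigma>_def[symmetric]
      using \<sigma>_pos[OF y] by simp
    show "smooth_real (\<rho> i)" for i
    proof (rule smooth_realI, rule smooth_fun_local)
      fix m U p u assume p: "manifold_plots n M A m U p" and u: "u \<in> U"
      obtain V k where V: "u \<in> V" "V \<subseteq> U" "openin (Euclidean_space m) V"
          "\<And>v. v \<in> V \<Longrightarrow> \<forall>i\<ge>k. \<theta> i (p v) = 0"
        using locfin[OF p u] by blast
      have pV: "manifold_plots n M A m V p" by (rule plot_subset[OF p V(3,2)])
      have "smooth_fun m V (\<lambda>v. \<Sum>i<k. \<theta> i (p v))"
        by (rule smooth_fun_sum[OF V(3)]) (rule smooth_realD[OF \<theta>sm pV])
      then have "smooth_fun m V (\<lambda>v. \<sigma> (p v))"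
        by (rule smooth_fun_cong[OF V(3)]) (rule \<sigma>_eq[OF V(4)])
      moreover have "\<sigma> (p v) \<noteq> 0" if "v \<in> V" for v
        using \<sigma>_pos plot_into[OF pV] that by (metis funcset_mem less_irrefl)
      ultimately have "smooth_fun m V (\<lambda>v. inverse (\<sigma> (p v)))"
        by (rule smooth_fun_inverse[OF V(3)])
      then have "smooth_fun m V (\<lambda>v. \<rho> i (p v))"
        unfolding \<rho>_def by (intro smooth_fun_mult[OF V(3)] smooth_realD[OF \<theta>sm pV])
      then show "\<exists>V. u \<in> V \<and> V \<subseteq> U \<and> openin (Euclidean_space m) V \<and> smooth_fun m V (\<lambda>u. \<rho> i (p u))"
        using V by blast
    qed (rule plot_open)
  qed
qed

section \<open>Lifting along linear subductions\<close>

text \<open>\<open>g \<circ> inv_into W \<phi>\<close> is a plot of \<open>W2\<close>, so it has a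
  lift \<open>q\<close> near \<open>\<phi> x\<close>, and \<open>h\<close> is
  \<open>q \<circ> \<phi>\<close>. The last conclusion is smoothness of \<open>h\<close> on
  \<open>S\<close>, phrased by plots with values in \<open>S\<close>.\<close>

lemma local_lift:
  assumes f: "linear_subduction W1 P1 W2 P2 f"
    and g: "smooth_between (topspace M) (manifold_plots n M A) W2 P2 g"
    and W1: "diffeological_vector_space W1 P1"
    and x: "x \<in> topspace M"
  obtains S h where "openin M S" "x \<in> S" "\<And>y. y \<in> S \<Longrightarrow> h y \<in> W1 \<and> f (h y) = g y"
    "\<And>m U p. manifold_plots n M A m U p \<Longrightarrow> p ` U \<subseteq> S \<Longrightarrow> P1 m U (h \<circ> p)"
proof -
  obtain W \<phi> where A: "(W, \<phi>) \<in> A" and xW: "x \<in> W" using charts_cover x by auto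
  interpret W1: diffeological_space W1 P1 using W1 by (rule dvs_diffeological_space)
  have "P2 n (\<phi> ` W) (g \<circ> inv_into W \<phi>)"
    using g chart_inverse_plot[OF A] by (simp add: smooth_between_def)
  moreover have "\<forall>n U p. P2 n U p \<longrightarrow>
      (\<forall>u\<in>U. \<exists>U' q. u \<in> U' \<and> U' \<subseteq> U \<and> P1 n U' q \<and> (\<forall>x\<in>U'. f (q x) = p x))"
    using f unfolding linear_subduction_def by (elim conjE) assumption
  ultimately have "\<exists>U' q. \<phi> x \<in> U' \<and> U' \<subseteq> \<phi> ` W \<and> P1 n U' q \<and>
      (\<forall>z\<in>U'. f (q z) = (g \<circ> inv_into W \<phi>) z)"
    using imageI[OF xW, of \<phi>] by blast
  then obtain V q where V: "\<phi> x \<in> V" "V \<subseteq> \<phi> ` W" "P1 n V q"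
      "\<And>z. z \<in> V \<Longrightarrow> f (q z) = g (inv_into W \<phi> z)"
    by auto
  have Vo: "openin (Euclidean_space n) V" by (rule W1.plot_open[OF V(3)])
  let ?S = "{y \<in> W. \<phi> y \<in> V}"
  show ?thesis
  proof
    show "openin M ?S" by (rule chart_open_preimage[OF A Vo V(2)])
    show "x \<in> ?S" using xW V(1) by simp
    show "(q \<circ> \<phi>) y \<in> W1 \<and> f ((q \<circ> \<phi>) y) = g y" if "y \<in> ?S" for y
      using that V(4) W1.plot_into[OF V(3)] inv_into_f_f[OF chart_inj_on[OF A]] by auto
    show "P1 m U (q \<circ> \<phi> \<circ> p)" if p: "manifold_plots n M A m U p" and pS: "p ` U \<subseteq> ?S" for m U p
    proof -
      have "{u \<in> U. p u \<in> W} = U" using pS by auto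
      then have "smooth_map m U n (\<phi> ` W) (\<phi> \<circ> p)"
        using p A by (fastforce simp: manifold_plots_def)
      then have "smooth_map m U n V (\<phi> \<circ> p)"
        using pS by (auto simp: smooth_map_def)
      then show ?thesis
        unfolding o_assoc[symmetric] by (rule W1.plot_comp[OF V(3) plot_open[OF p]])
    qed
  qed
qed

lemma global_lift:
  assumes f: "linear_subduction W1 P1 W2 P2 f"
    and g: "smooth_between (topspace M) (manifold_plots n M A) W2 P2 g"
    and W1: "diffeological_vector_space W1 P1"
  obtains h where "smooth_between (topspace M) (manifold_plots n M A) W1 P1 h"
    "\<And>y. y \<in> topspace M \<Longrightarrow> f (h y) = g y"
proof (cases "topspace M = {}")
  \<comment> \<open>The partition of unity enumerates points of \<open>M\<close>, so the empty
    manifold is separate: all its plots have empty domain.\<close>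
  case True
  have "P1 m U ((\<lambda>_. 0) \<circ> p)" if p: "manifold_plots n M A m U p" for m U p
  proof -
    have "U = {}" using plot_into[OF p] True by auto
    then show ?thesis
      using diffeological_space.plot_empty[OF dvs_diffeological_space[OF W1]] by simp
  qed
  then have "smooth_between (topspace M) (manifold_plots n M A) W1 P1 (\<lambda>_. 0)"
    using True unfolding smooth_between_def by blast
  then show ?thesis by (rule that) (use True in blast)
next
  case False
  interpret W1: diffeological_space W1 P1 using W1 by (rule dvs_diffeological_space)
  have sub: "subspace W1" using W1 by (rule dvs_subspace)
  define lift where "lift x S h \<longleftrightarrow> openin M S \<and> x \<in> S \<and> (\<forall>y\<in>S. h y \<in> W1 \<and> f (h y) = g y) \<and>
      (\<forall>m U p. manifold_plots n M A m U p \<longrightarrow> p ` U \<subseteq> S \<longrightarrow> P1 m U (h \<circ> p))" for x S h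
  have "\<exists>S h. lift x S h" if "x \<in> topspace M" for x
    by (rule local_lift[OF f g W1 that]) (unfold lift_def, blast)
  then obtain S h where lift: "\<And>x. x \<in> topspace M \<Longrightarrow> lift x (S x) (h x)"
    by metis
  have S: "openin M (S x) \<and> x \<in> S x" "y \<in> S x \<Longrightarrow> h x y \<in> W1" "y \<in> S x \<Longrightarrow> f (h x y) = g y"
      "manifold_plots n M A m U p \<Longrightarrow> p ` U \<subseteq> S x \<Longrightarrow> P1 m U (h x \<circ> p)"
    if "x \<in> topspace M" for x y m U p
    using lift[OF that] unfolding lift_def by auto
  show ?thesis
  proof (rule partition_of_unity[OF S(1) False])
    fix c K and \<rho> :: "nat \<Rightarrow> 'a \<Rightarrow> real"
    assume pou: "\<And>i. c i \<in> topspace M" "\<And>i. closedin M (K i)" "\<And>i. K i \<subseteq> S (c i)"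
      "\<And>i. smooth_real (\<rho> i)" "\<And>i y. y \<notin> K i \<Longrightarrow> \<rho> i y = 0"
      "\<And>m U p u. manifold_plots n M A m U p \<Longrightarrow> u \<in> U \<Longrightarrow>
        \<exists>V k. u \<in> V \<and> V \<subseteq> U \<and> openin (Euclidean_space m) V \<and> (\<forall>v\<in>V. \<forall>i\<ge>k. \<rho> i (p v) = 0)"
      "\<And>y. y \<in> topspace M \<Longrightarrow> finite {i. \<rho> i y \<noteq> 0}"
      "\<And>y. y \<in> topspace M \<Longrightarrow> (\<Sum>i | \<rho> i y \<noteq> 0. \<rho> i y) = 1"
    \<comment> \<open>Only indices of nonzero weight enter, since \<open>h (c i) y\<close> is known
      to lie in \<open>W1\<close> only for \<open>y\<close> in \<open>S (c i)\<close>.\<close>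
    define H where "H y = (\<Sum>i | \<rho> i y \<noteq> 0. \<rho> i y *\<^sub>R h (c i) y)" for y
    have hW1: "h (c i) y \<in> W1" "f (h (c i) y) = g y" if "\<rho> i y \<noteq> 0" for i y
      using that pou(3,5) S(2,3)[OF pou(1)] by blast+
    \<comment> \<open>On the preimage of \<open>S (c i)\<close> this is a smooth function times a
      plot; off \<open>K i\<close> it is 0. The two open sets cover \<open>U\<close> because
      \<open>K i \<subseteq> S (c i)\<close>.\<close>
    have term_plot: "P1 m U (\<lambda>u. \<rho> i (p u) *\<^sub>R h (c i) (p u))" if p: "manifold_plots n M A m U p" for m U p i
    proof (rule W1.plot_local)
      fix u assume u: "u \<in> U"
      show "\<exists>V. u \<in> V \<and> V \<subseteq> U \<and> P1 m V (\<lambda>u. \<rho> i (p u) *\<^sub>R h (c i) (p u))"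
      proof (cases "p u \<in> S (c i)")
        case True
        let ?V = "{u \<in> U. p u \<in> S (c i)}"
        have V: "openin (Euclidean_space m) ?V"
          by (rule openin_plot_preimage[OF p]) (use S(1)[OF pou(1)] in blast)
        have pV: "manifold_plots n M A m ?V p" by (rule plot_subset[OF p V]) auto
        have "P1 m ?V (h (c i) \<circ> p)" by (rule S(4)[OF pou(1) pV]) auto
        from dvs_plot_scaleR[OF W1, OF V smooth_realD[OF pou(4) pV] this]
        have "P1 m ?V (\<lambda>u. \<rho> i (p u) *\<^sub>R h (c i) (p u))" by (simp only: o_def)
        moreover have "u \<in> ?V" "?V \<subseteq> U" using u True by auto
        ultimately show ?thesis by (intro exI[of _ ?V]) (intro conjI)
      next
        case False
        let ?V = "{u \<in> U. p u \<in> topspace M - K i}"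
        have V: "openin (Euclidean_space m) ?V"
          by (rule openin_plot_preimage[OF p]) (use pou(2) in blast)
        have "P1 m ?V (\<lambda>u. \<rho> i (p u) *\<^sub>R h (c i) (p u))"
          by (rule W1.plot_cong[OF W1.plot_const[OF V subspace_0[OF sub]]]) (simp add: pou(5))
        moreover have "u \<in> ?V" using u False pou(3) funcset_mem[OF plot_into[OF p] u] by blast
        moreover have "?V \<subseteq> U" by blast
        ultimately show ?thesis by (intro exI[of _ ?V]) (intro conjI)
      qed
    qed
    show thesis
    proof
      show "smooth_between (topspace M) (manifold_plots n M A) W1 P1 H"
        unfolding smooth_between_def
      proof (intro conjI allI impI)
        show "H \<in> topspace M \<rightarrow> W1"
          unfolding H_def using hW1(1) by (auto intro!: subspace_sum[OF sub] subspace_scale[OF sub])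
        fix m U p assume p: "manifold_plots n M A m U p"
        show "P1 m U (H \<circ> p)"
        proof (rule W1.plot_local)
          fix u assume u: "u \<in> U"
          obtain V k where V: "u \<in> V" "V \<subseteq> U" "openin (Euclidean_space m) V"
              "\<And>v i. v \<in> V \<Longrightarrow> i \<ge> k \<Longrightarrow> \<rho> i (p v) = 0"
            using pou(6)[OF p u] by blast
          have pV: "manifold_plots n M A m V p" by (rule plot_subset[OF p V(3,2)])
          have *: "P1 m V (\<lambda>v. \<Sum>i<k. \<rho> i (p v) *\<^sub>R h (c i) (p v))"
            by (rule dvs_plot_sum[OF W1, OF V(3) term_plot[OF pV]])
          have "P1 m V (H \<circ> p)"
          proof (rule W1.plot_cong[OF *])
            fix v assume "v \<in> V"
            then show "(H \<circ> p) v = (\<Sum>i<k. \<rho> i (p v) *\<^sub>R h (c i) (p v))"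
              unfolding H_def o_def using V(4)
              by (intro sum.mono_neutral_left) (auto simp: not_less[symmetric])
          qed
          then show "\<exists>V. u \<in> V \<and> V \<subseteq> U \<and> P1 m V (H \<circ> p)" using V by blast
        qed
      qed
      show "f (H y) = g y" if y: "y \<in> topspace M" for y
      proof -
        \<comment> \<open>The lifts of \<open>g y\<close> form an affine subspace, and a combination
          of lifts with weights of sum 1 stays in it.\<close>
        have "f (H y) = (\<Sum>i | \<rho> i y \<noteq> 0. \<rho> i y *\<^sub>R f (h (c i) y))"
          unfolding H_def using f hW1(1) pou(7)[OF y]
          by (intro additive_homogeneous_sum[OF sub]) (auto simp: linear_subduction_def smooth_linear_def)
        also have "\<dots> = (\<Sum>i | \<rho> i y \<noteq> 0. \<rho> i y *\<^sub>R g y)"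
          using hW1(2) by (intro sum.cong) auto
        also have "\<dots> = g y"
          by (simp add: scaleR_sum_left[symmetric] pou(8)[OF y])
        finally show ?thesis .
      qed
    qed
  qed
qed

end

theorem corollary6p4:
  fixes M :: "'a topology" and A :: "('a set \<times> ('a \<Rightarrow> nat \<Rightarrow> real)) set" and n :: nat
  assumes "smooth_manifold n M A"
  shows "projective_dvs TYPE('b::real_vector) TYPE('c::real_vector)
           (free_vs (topspace M)) (free_plots (topspace M) (manifold_plots n M A))"
proof -
  interpret smooth_manifold n M A by fact
  let ?X = "topspace M" and ?P = "manifold_plots n M A"
  show ?thesis
    unfolding projective_dvs_def
  proof (intro conjI allI impI diffeological_vector_space_free)
    fix W1 :: "'b set" and P1 and W2 :: "'c set" and P2 f g
    assume "diffeological_vector_space W1 P1 \<and> diffeological_vector_space W2 P2 \<and>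
        linear_subduction W1 P1 W2 P2 f \<and> smooth_linear (free_vs ?X) (free_plots ?X ?P) W2 P2 g"
    then have W1: "diffeological_vector_space W1 P1" and f: "linear_subduction W1 P1 W2 P2 f"
      and g: "smooth_linear (free_vs ?X) (free_plots ?X ?P) W2 P2 g" by auto
    have "smooth_between ?X ?P W2 P2 (\<lambda>x. g (free_basis x))"
      unfolding smooth_between_def
    proof (intro conjI allI impI)
      show "(\<lambda>x. g (free_basis x)) \<in> ?X \<rightarrow> W2"
      proof
        show "g (free_basis x) \<in> W2" if "x \<in> ?X" for x
          using g free_basis_in_free_vs[OF that] unfolding smooth_linear_def smooth_between_def
          by blast
      qed
      fix m U p assume "?P m U p"
      from free_plot_free_basis[OF this] g
      have "P2 m U (g \<circ> (\<lambda>u. free_basis (p u)))"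
        unfolding smooth_linear_def smooth_between_def by blast
      then show "P2 m U ((\<lambda>x. g (free_basis x)) \<circ> p)" by (simp only: o_def)
    qed
    then obtain h where h: "smooth_between ?X ?P W1 P1 h" "\<And>x. x \<in> ?X \<Longrightarrow> f (h x) = g (free_basis x)"
      using global_lift[OF f _ W1] by blast
    \<comment> \<open>Both sides are linear in \<open>v\<close> on the free space, and on basis
      vectors they agree by the choice of \<open>h\<close>.\<close>
    have "g v = f (free_extension h v)" if v: "v \<in> free_vs ?X" for v
    proof -
      have keys: "x \<in> ?X" if "x \<in> Poly_Mapping.keys v" for x using v that by (auto simp: free_vs_def)
      have "g v = free_extension (\<lambda>x. g (free_basis x)) v"
        using g v by (intro eq_free_extension) (auto simp: smooth_linear_def)
      also have "\<dots> = (\<Sum>x\<in>Poly_Mapping.keys v. Poly_Mapping.lookup v x *\<^sub>R f (h x))"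
        unfolding free_extension_def using h(2) keys by (intro sum.cong) auto
      also have "\<dots> = f (free_extension h v)"
        unfolding free_extension_def using f h(1) keys
        by (intro additive_homogeneous_sum[OF dvs_subspace[OF W1], symmetric])
          (auto simp: linear_subduction_def smooth_linear_def smooth_between_def)
      finally show ?thesis .
    qed
    then show "\<exists>h. smooth_linear (free_vs ?X) (free_plots ?X ?P) W1 P1 h \<and> (\<forall>x\<in>free_vs ?X. g x = f (h x))"
      using smooth_linear_free_extension[OF W1 h(1)] by blast
  qed
qed

end
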